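(* Assume $c \ge c_0 > 0$ a.e. in $\Omega$ for some constant $c_0$, and $c - \operatorname{div} b \ge 0$ a.e. in $\Omega$. Let $(u,p) \in H^1_0 \times D$ be the exact solution of problem (P1) with data $f \in L^2$, and let $(\tilde u, \tilde p) \in H^1_0 \times D$ be arbitrary. Then $$\|u-\tilde u\|_{c-\operatorname{div} b}^2 + \|\nabla(u-\tilde u)\|_{A}^2 + \|p-\tilde p\|_{A^{-1}}^2 + \|b\cdot\nabla(u-\tilde u) - \operatorname{div}(p-\tilde p)\|_{c^{-1}}^2 = \mathcal M_1(\tilde u,\tilde p),$$ where $$\mathcal M_1(\tilde u,\tilde p) := \|f - c\tilde u - b\cdot\nabla\tilde u + \operatorname{div}\tilde p\|_{c^{-1}}^2 + \|\tilde p - A\nabla\tilde u\|_{A^{-1}}^2 .$$ Moreover, if $f \neq 0$, then, writing $\|(x,y)\|_1^2 := \|x\|_{c-\operatorname{div} b}^2 + \|\nabla x\|_A^2 + \|y\|_{A^{-1}}^2 + \|b\cdot\nabla x - \operatorname{div} y\|_{c^{-1}}^2$, $$\frac{\|(u,p)-(\tilde u,\tilde p)\|_1^2}{\|(u,p)\|_1^2} = \frac{\mathcal M_1(\tilde u,\tilde p)}{\|f\|_{c^{-1}}^2}.$$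
   Context: $\Omega \subset \mathbb R^d$ ($d\ge1$) is an arbitrary open domain (bounded or unbounded). All function spaces are over $\mathbb C$. $L^2 = L^2(\Omega)$ (scalar or vector valued) has inner product $(x,y) = \int_\Omega x\cdot\bar y$ and norm $\|\cdot\|$. For a real scalar or Hermitian-matrix valued weight $\gamma \in L^\infty(\Omega)$ with $\gamma\ge 0$, $\|v\|_\gamma^2 := (\gamma v, v)$. $H^1 = \{\varphi\in L^2 : \nabla\varphi\in L^2\}$, $D = \{\psi \in L^2(\Omega;\mathbb C^d) : \operatorname{div}\psi \in L^2\}$, and $H^1_0$ is the closure of $C_c^\infty(\Omega)$ in $H^1$. Coefficients: $A \in L^\infty(\Omega;\mathbb C^{d\times d})$ is pointwise Hermitian and satisfies $\alpha\|\varphi\|^2 \le (A\varphi,\varphi) \le \beta\|\varphi\|^2$ for all $\varphi\in L^2(\Omega;\mathbb C^d)$ with constants $0<\alpha\le\beta$; $b\in L^\infty(\Omega;\mathbb R^d)$ is real with distributional divergence $\operatorname{div} b \in L^\infty(\Omega)$; $c\in L^\infty(\Omega)$ is real valued; $f\in L^2$. Problem (P1): find $(u,p)\in H^1_0\times D$ with $p = A\nabla u$ and $-\operatorname{div} p + b\cdot\nabla u + c\,u = f$ a.e. in $\Omega$. *)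

theory Defs
  imports "HOL-Analysis.Analysis"
begin

definition pd :: "'n::finite \<Rightarrow> (real^'n \<Rightarrow> complex) \<Rightarrow> real^'n \<Rightarrow> complex" where
  "pd i f = (\<lambda>x. frechet_derivative f (at x) (axis i 1))"

definition smooth_fun :: "(real^'n::finite \<Rightarrow> complex) \<Rightarrow> bool" where
  "smooth_fun f \<longleftrightarrow> (\<forall>ds::'n list. \<forall>x. (foldr pd ds f) differentiable (at x))"

definition tsupport :: "(real^'n::finite \<Rightarrow> complex) \<Rightarrow> (real^'n) set" where
  "tsupport f = closure {x. f x \<noteq> 0}"

definition test_fun :: "(real^'n::finite) set \<Rightarrow> (real^'n \<Rightarrow> complex) \<Rightarrow> bool" where
  "test_fun \<Omega> f \<longleftrightarrow> smooth_fun f \<and> compact (tsupport f) \<and> tsupport f \<subseteq> \<Omega>"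

definition cgrad :: "(real^'n::finite \<Rightarrow> complex) \<Rightarrow> real^'n \<Rightarrow> complex^'n" where
  "cgrad f = (\<lambda>x. \<chi> i. pd i f x)"

definition cinner :: "complex^'n::finite \<Rightarrow> complex^'n \<Rightarrow> complex" where
  "cinner v w = (\<Sum>i\<in>UNIV. v $ i * cnj (w $ i))"

definition L2 :: "(real^'n::finite) set \<Rightarrow> (real^'n \<Rightarrow> complex) \<Rightarrow> bool" where
  "L2 \<Omega> v \<longleftrightarrow> v \<in> borel_measurable (lebesgue_on \<Omega>)
     \<and> integrable (lebesgue_on \<Omega>) (\<lambda>x. (cmod (v x))\<^sup>2)"

definition L2v :: "(real^'n::finite) set \<Rightarrow> (real^'n \<Rightarrow> complex^'n) \<Rightarrow> bool" where
  "L2v \<Omega> v \<longleftrightarrow> v \<in> borel_measurable (lebesgue_on \<Omega>)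
     \<and> integrable (lebesgue_on \<Omega>) (\<lambda>x. (norm (v x))\<^sup>2)"

definition Linf :: "(real^'n::finite) set \<Rightarrow> (real^'n \<Rightarrow> 'b::real_normed_vector) \<Rightarrow> bool" where
  "Linf \<Omega> g \<longleftrightarrow> g \<in> borel_measurable (lebesgue_on \<Omega>)
     \<and> (\<exists>M. AE x in lebesgue_on \<Omega>. norm (g x) \<le> M)"

definition L2nsq :: "(real^'n::finite) set \<Rightarrow> (real^'n \<Rightarrow> complex) \<Rightarrow> real" where
  "L2nsq \<Omega> v = (LINT x|lebesgue_on \<Omega>. (cmod (v x))\<^sup>2)"

definition L2vnsq :: "(real^'n::finite) set \<Rightarrow> (real^'n \<Rightarrow> complex^'n) \<Rightarrow> real" where
  "L2vnsq \<Omega> v = (LINT x|lebesgue_on \<Omega>. (norm (v x))\<^sup>2)"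

definition wnsq :: "(real^'n::finite) set \<Rightarrow> (real^'n \<Rightarrow> real) \<Rightarrow> (real^'n \<Rightarrow> complex) \<Rightarrow> real" where
  "wnsq \<Omega> \<gamma> v = Re (LINT x|lebesgue_on \<Omega>. complex_of_real (\<gamma> x) * v x * cnj (v x))"

definition mwnsq :: "(real^'n::finite) set \<Rightarrow> (real^'n \<Rightarrow> complex^'n^'n) \<Rightarrow> (real^'n \<Rightarrow> complex^'n) \<Rightarrow> real" where
  "mwnsq \<Omega> \<Gamma> v = Re (LINT x|lebesgue_on \<Omega>. cinner (\<Gamma> x *v v x) (v x))"

definition weak_grad :: "(real^'n::finite) set \<Rightarrow> (real^'n \<Rightarrow> complex) \<Rightarrow> (real^'n \<Rightarrow> complex^'n) \<Rightarrow> bool" where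
  "weak_grad \<Omega> u G \<longleftrightarrow> (\<forall>\<psi>. test_fun \<Omega> \<psi> \<longrightarrow> (\<forall>i.
     (LINT x|lebesgue_on \<Omega>. u x * pd i \<psi> x) = - (LINT x|lebesgue_on \<Omega>. G x $ i * \<psi> x)))"

definition weak_div :: "(real^'n::finite) set \<Rightarrow> (real^'n \<Rightarrow> complex^'n) \<Rightarrow> (real^'n \<Rightarrow> complex) \<Rightarrow> bool" where
  "weak_div \<Omega> p q \<longleftrightarrow> (\<forall>\<psi>. test_fun \<Omega> \<psi> \<longrightarrow>
     (LINT x|lebesgue_on \<Omega>. (\<Sum>i\<in>UNIV. p x $ i * pd i \<psi> x)) = - (LINT x|lebesgue_on \<Omega>. q x * \<psi> x))"

definition H1 :: "(real^'n::finite) set \<Rightarrow> (real^'n \<Rightarrow> complex) \<Rightarrow> bool" where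
  "H1 \<Omega> u \<longleftrightarrow> L2 \<Omega> u \<and> (\<exists>G. L2v \<Omega> G \<and> weak_grad \<Omega> u G)"

definition Hdiv :: "(real^'n::finite) set \<Rightarrow> (real^'n \<Rightarrow> complex^'n) \<Rightarrow> bool" where
  "Hdiv \<Omega> p \<longleftrightarrow> L2v \<Omega> p \<and> (\<exists>q. L2 \<Omega> q \<and> weak_div \<Omega> p q)"

definition H10 :: "(real^'n::finite) set \<Rightarrow> (real^'n \<Rightarrow> complex) \<Rightarrow> bool" where
  "H10 \<Omega> u \<longleftrightarrow> L2 \<Omega> u \<and> (\<exists>G. L2v \<Omega> G \<and> weak_grad \<Omega> u G \<and>
     (\<exists>\<phi>::nat \<Rightarrow> real^'n \<Rightarrow> complex. (\<forall>k. test_fun \<Omega> (\<phi> k)) \<and>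
        ((\<lambda>k. L2nsq \<Omega> (\<lambda>x. \<phi> k x - u x) + L2vnsq \<Omega> (\<lambda>x. cgrad (\<phi> k) x - G x)) \<longlonglongrightarrow> 0)))"

definition bdot :: "real^'n::finite \<Rightarrow> complex^'n \<Rightarrow> complex" where
  "bdot b v = (\<Sum>i\<in>UNIV. complex_of_real (b $ i) * v $ i)"

definition cvec :: "real^'n::finite \<Rightarrow> complex^'n" where
  "cvec b = (\<chi> i. complex_of_real (b $ i))"


text \<open>The squared norm ||(x,y)||_1^2 of the paper, with gx = grad x and dy = div y.\<close>
definition norm1sq :: "(real^'n::finite) set \<Rightarrow> (real^'n \<Rightarrow> complex^'n^'n) \<Rightarrow> (real^'n \<Rightarrow> real^'n)
    \<Rightarrow> (real^'n \<Rightarrow> real) \<Rightarrow> (real^'n \<Rightarrow> real)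
    \<Rightarrow> (real^'n \<Rightarrow> complex) \<Rightarrow> (real^'n \<Rightarrow> complex^'n) \<Rightarrow> (real^'n \<Rightarrow> complex^'n) \<Rightarrow> (real^'n \<Rightarrow> complex) \<Rightarrow> real" where
  "norm1sq \<Omega> A b c divb x gx y dy =
     wnsq \<Omega> (\<lambda>z. c z - divb z) x + mwnsq \<Omega> A gx + mwnsq \<Omega> (\<lambda>z. matrix_inv (A z)) y
     + wnsq \<Omega> (\<lambda>z. 1 / c z) (\<lambda>z. bdot (b z) (gx z) - dy z)"

text \<open>The majorant M_1(ut, pt), with gut = grad ut and dpt = div pt.\<close>
definition M1 :: "(real^'n::finite) set \<Rightarrow> (real^'n \<Rightarrow> complex^'n^'n) \<Rightarrow> (real^'n \<Rightarrow> real^'n)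
    \<Rightarrow> (real^'n \<Rightarrow> real) \<Rightarrow> (real^'n \<Rightarrow> complex)
    \<Rightarrow> (real^'n \<Rightarrow> complex) \<Rightarrow> (real^'n \<Rightarrow> complex^'n) \<Rightarrow> (real^'n \<Rightarrow> complex^'n) \<Rightarrow> (real^'n \<Rightarrow> complex) \<Rightarrow> real" where
  "M1 \<Omega> A b c f ut gut pt dpt =
     wnsq \<Omega> (\<lambda>z. 1 / c z) (\<lambda>z. f z - complex_of_real (c z) * ut z - bdot (b z) (gut z) + dpt z)
     + mwnsq \<Omega> (\<lambda>z. matrix_inv (A z)) (\<lambda>z. pt z - A z *v gut z)"

end

theory Submission
  imports Defs
begin

text \<open>Write e, g, q, dq for the errors u - ut, grad e, p - pt, div q. By the equation, the two residuals
  in M1 are c e + (b . g - dq) and A g - q. Expanding their weighted squares gives the left-hand side plus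
  cross terms: those of e with b . g integrate to -(div b) |e|^2, and those coupling (e, g) with (dq, q)
  integrate to zero because e is a limit of test functions. The second claim is the same expansion with
  e = u, q = p, whose residuals are f and 0.

  The definition of H10 provides a limit of gradients that is a priori only some weak gradient of u, so
  uniqueness of weak gradients is needed: smooth bumps approximate indicators of boxes, and a function
  whose integrals over all small boxes vanish is zero almost everywhere by Lebesgue differentiation.\<close>

section \<open>Smooth functions and test functions\<close>

text \<open>Both residuals are measured in the inverse weights \<open>1 / c\<close> and
  \<open>matrix_inv (A x)\<close>, so these have to be bounded and measurable before the squares can
  be integrated term by term. For c the lower bound c0 settles it. For A the obstacle is that
  ellipticity is assumed only after integration over \<Omega>: testing it with a constant vector cut
  off to the set where the pointwise inequality fails recovers that inequality almost everywhere,
  and with it the inverse and its bound. The inverse weights are what makes an identity possible: c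
  cancels against 1/c and A against its inverse, so the cross terms carry no coefficient except b.
  The pairings that remain involve weak derivatives, which are known only against test functions;
  approximating e moves each of them there. For the advection term, b being real makes e times
  conj(b . g) plus its conjugate the b-derivative of e times conj e, and for a test function this
  product is again a test function.\<close>

lemma pd_eqI: "(f has_derivative f') (at x) \<Longrightarrow> pd i f x = f' (axis i 1)"
  unfolding pd_def by (metis frechet_derivative_at)

lemma pd_const: "pd i (\<lambda>x. k) = (\<lambda>x. 0)"
  by (rule ext, rule pd_eqI[where f'="\<lambda>_. 0"]) simp

lemma pd_add:
  assumes "\<And>x. f differentiable (at x)" "\<And>x. g differentiable (at x)"
  shows "pd i (\<lambda>x. f x + g x) = (\<lambda>x. pd i f x + pd i g x)"
proof
  fix x
  show "pd i (\<lambda>x. f x + g x) x = pd i f x + pd i g x"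
    using pd_eqI[OF has_derivative_add[OF assms(1)[unfolded frechet_derivative_works]
        assms(2)[unfolded frechet_derivative_works]], of i x] by (simp add: pd_def)
qed

lemma pd_mult:
  assumes "\<And>x. f differentiable (at x)" "\<And>x. g differentiable (at x)"
  shows "pd i (\<lambda>x. f x * g x) = (\<lambda>x. f x * pd i g x + pd i f x * g x)"
proof
  fix x
  show "pd i (\<lambda>x. f x * g x) x = f x * pd i g x + pd i f x * g x"
    using pd_eqI[OF has_derivative_mult[OF assms(1)[unfolded frechet_derivative_works]
        assms(2)[unfolded frechet_derivative_works]], of i x] by (simp add: pd_def)
qed

lemma pd_cnj:
  assumes "\<And>x. f differentiable (at x)"
  shows "pd i (\<lambda>x. cnj (f x)) = (\<lambda>x. cnj (pd i f x))"
proof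
  fix x
  show "pd i (\<lambda>x. cnj (f x)) x = cnj (pd i f x)"
    using pd_eqI[OF has_derivative_cnj[OF assms[unfolded frechet_derivative_works]], of i x]
    by (simp add: pd_def)
qed

text \<open>The algebra generated by S and the constants. \<open>smooth_fun\<close> asks for
  differentiability of every iterated partial derivative, so an induction over the directions needs
  a family that differentiation does not leave; products turn into sums of products, which is what
  this closure absorbs.\<close>

inductive_set fun_alg :: "(real^'n::finite \<Rightarrow> complex) set \<Rightarrow> (real^'n \<Rightarrow> complex) set"
  for S where
  base: "f \<in> S \<Longrightarrow> f \<in> fun_alg S"
| const: "(\<lambda>x. k) \<in> fun_alg S"
| add: "f \<in> fun_alg S \<Longrightarrow> g \<in> fun_alg S \<Longrightarrow> (\<lambda>x. f x + g x) \<in> fun_alg S"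
| mult: "f \<in> fun_alg S \<Longrightarrow> g \<in> fun_alg S \<Longrightarrow> (\<lambda>x. f x * g x) \<in> fun_alg S"

lemma fun_alg_closed:
  assumes "\<And>f x. f \<in> S \<Longrightarrow> f differentiable (at x)" "\<And>f i. f \<in> S \<Longrightarrow> pd i f \<in> fun_alg S"
    and "f \<in> fun_alg S"
  shows "(\<forall>x. f differentiable (at x)) \<and> (\<forall>i. pd i f \<in> fun_alg S)"
  using assms(3)
proof induction
  case (base f)
  then show ?case using assms by blast
next
  case (const k)
  then show ?case by (simp add: pd_const fun_alg.const)
next
  case (add f g)
  then show ?case by (auto simp: pd_add intro!: fun_alg.add differentiable_add)
next
  case (mult f g)
  then show ?case by (auto simp: pd_mult intro!: fun_alg.add fun_alg.mult differentiable_mult)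
qed

text \<open>By the Leibniz rule only the generators have to be differentiated, and only once: every
  \<open>pd i\<close> then maps the algebra into itself, so induction on the list of directions
  keeps all iterated derivatives among differentiable functions.\<close>

lemma smooth_fun_alg:
  assumes "\<And>f x. f \<in> S \<Longrightarrow> f differentiable (at x)" "\<And>f i. f \<in> S \<Longrightarrow> pd i f \<in> fun_alg S"
    and "f \<in> fun_alg S"
  shows "smooth_fun f"
proof -
  have "foldr pd ds f \<in> fun_alg S" for ds
    by (induction ds) (use assms fun_alg_closed[OF assms(1,2)] in auto)
  then show ?thesis
    unfolding smooth_fun_def using fun_alg_closed[OF assms(1,2)] by blast
qed

lemma smooth_fun_differentiable: "smooth_fun f \<Longrightarrow> f differentiable (at x)"
  unfolding smooth_fun_def by (metis foldr.simps(1) id_apply)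

lemma smooth_fun_pd: "smooth_fun f \<Longrightarrow> smooth_fun (pd i f)"
  unfolding smooth_fun_def
proof (intro allI)
  fix ds x assume *: "\<forall>ds x. foldr pd ds f differentiable at x"
  show "foldr pd ds (pd i f) differentiable at x"
    using *[rule_format, of "ds @ [i]"] by simp
qed

text \<open>Taking all smooth functions as generators gives closure under sums and products at once,
  without a Leibniz formula for higher derivatives.\<close>

lemma smooth_fun_fun_alg: "f \<in> fun_alg {f. smooth_fun f} \<Longrightarrow> smooth_fun f"
  by (rule smooth_fun_alg[where S="{f. smooth_fun f}"])
    (auto intro: smooth_fun_differentiable smooth_fun_pd fun_alg.base)

lemma smooth_fun_add: "smooth_fun f \<Longrightarrow> smooth_fun g \<Longrightarrow> smooth_fun (\<lambda>x. f x + g x)"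
  by (rule smooth_fun_fun_alg[OF fun_alg.add[OF fun_alg.base fun_alg.base]]) auto

lemma smooth_fun_mult: "smooth_fun f \<Longrightarrow> smooth_fun g \<Longrightarrow> smooth_fun (\<lambda>x. f x * g x)"
  by (rule smooth_fun_fun_alg[OF fun_alg.mult[OF fun_alg.base fun_alg.base]]) auto

lemma smooth_fun_const: "smooth_fun (\<lambda>x. k)"
  by (rule smooth_fun_fun_alg[OF fun_alg.const])

lemma smooth_fun_prod:
  "(\<And>i. i \<in> I \<Longrightarrow> smooth_fun (g i)) \<Longrightarrow> smooth_fun (\<lambda>x. \<Prod>i\<in>I. g i x)"
  by (induction I rule: infinite_finite_induct) (simp_all add: smooth_fun_const smooth_fun_mult)

lemma smooth_fun_diff:
  assumes "smooth_fun f" "smooth_fun g"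
  shows "smooth_fun (\<lambda>x. f x - g x)"
  using smooth_fun_add[OF assms(1) smooth_fun_mult[OF smooth_fun_const[of "-1"] assms(2)]] by simp

text \<open>Conjugation is not an operation of \<open>fun_alg\<close>, so the conjugates themselves
  serve as generators; \<open>pd\<close> commutes with \<open>cnj\<close>, hence they are closed
  under differentiation.\<close>

lemma smooth_fun_cnj:
  assumes "smooth_fun f"
  shows "smooth_fun (\<lambda>x. cnj (f x))"
proof (rule smooth_fun_alg[where S="(\<lambda>f x. cnj (f x)) ` {f. smooth_fun f}"])
  show "(\<lambda>x. cnj (f x)) \<in> fun_alg ((\<lambda>f x. cnj (f x)) ` {f. smooth_fun f})"
    using assms by (auto intro!: fun_alg.base)
next
  fix g :: "real^'n \<Rightarrow> complex" and x
  assume "g \<in> (\<lambda>f x. cnj (f x)) ` {f. smooth_fun f}"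
  then obtain h where h: "smooth_fun h" "g = (\<lambda>x. cnj (h x))" by auto
  show "g differentiable (at x)"
    using smooth_fun_differentiable[OF h(1), of x]
    unfolding h differentiable_def by (blast intro: has_derivative_cnj)
next
  fix g :: "real^'n \<Rightarrow> complex" and i
  assume "g \<in> (\<lambda>f x. cnj (f x)) ` {f. smooth_fun f}"
  then obtain h where h: "smooth_fun h" "g = (\<lambda>x. cnj (h x))" by auto
  show "pd i g \<in> fun_alg ((\<lambda>f x. cnj (f x)) ` {f. smooth_fun f})"
    unfolding h(2) using pd_cnj[OF smooth_fun_differentiable[OF h(1)], of i] smooth_fun_pd[OF h(1), of i]
    by (auto intro!: fun_alg.base)
qed

section \<open>Supports, and the operations that preserve test functions\<close>

lemma tsupport_subset:
  assumes "\<And>x. f x \<noteq> 0 \<Longrightarrow> x \<in> tsupport g"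
  shows "tsupport f \<subseteq> tsupport g"
  unfolding tsupport_def[of f]
  by (rule closure_minimal) (use assms in \<open>auto simp: tsupport_def\<close>)

lemma notin_tsupport: "x \<notin> tsupport f \<Longrightarrow> f x = 0"
  using closure_subset[of "{x. f x \<noteq> 0}"] unfolding tsupport_def by auto

lemma in_tsupport: "f x \<noteq> 0 \<Longrightarrow> x \<in> tsupport f"
  using notin_tsupport by blast

lemma test_fun_subset:
  assumes "test_fun \<Omega> g" "smooth_fun f" "\<And>x. f x \<noteq> 0 \<Longrightarrow> x \<in> tsupport g"
  shows "test_fun \<Omega> f"
proof -
  have *: "tsupport f \<subseteq> tsupport g" using assms(3) by (rule tsupport_subset)
  have "closed (tsupport f)" by (simp add: tsupport_def)
  with assms(1) have "compact (tsupport g \<inter> tsupport f)"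
    unfolding test_fun_def by (intro compact_Int_closed) auto
  with * have "compact (tsupport f)" by (simp add: Int_absorb1)
  then show ?thesis
    using assms(1,2) order_trans[OF *] unfolding test_fun_def by simp
qed

lemma test_fun_cnj:
  assumes "test_fun \<Omega> f"
  shows "test_fun \<Omega> (\<lambda>x. cnj (f x))"
proof (rule test_fun_subset[OF assms])
  show "smooth_fun (\<lambda>x. cnj (f x))"
    using assms by (simp add: test_fun_def smooth_fun_cnj)
qed (simp add: in_tsupport)

lemma test_fun_mult:
  assumes "test_fun \<Omega> f" "smooth_fun g"
  shows "test_fun \<Omega> (\<lambda>x. f x * g x)"
proof (rule test_fun_subset[OF assms(1)])
  show "smooth_fun (\<lambda>x. f x * g x)"
    using assms by (simp add: test_fun_def smooth_fun_mult)
qed (simp add: in_tsupport)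

lemma test_fun_pd:
  assumes "test_fun \<Omega> f"
  shows "test_fun \<Omega> (pd i f)"
proof (rule test_fun_subset[OF assms])
  show "smooth_fun (pd i f)" using assms by (auto simp: test_fun_def intro: smooth_fun_pd)
  fix x assume *: "pd i f x \<noteq> 0"
  show "x \<in> tsupport f"
  proof (rule ccontr)
    assume x: "x \<notin> tsupport f"
    \<comment> \<open>Outside the closed support f vanishes on a whole neighbourhood, which forces
      the derivative to vanish too; f x = 0 at the single point would not.\<close>
    have op: "open (- tsupport f)" by (simp add: tsupport_def open_Compl)
    have "(f has_derivative (\<lambda>_. 0)) (at x)"
    proof (rule has_derivative_transform_within_open[OF has_derivative_const[of 0] op])
      show "x \<in> - tsupport f" using x by simp
      show "0 = f y" if "y \<in> - tsupport f" for y using that notin_tsupport[of y f] by simp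
    qed
    from pd_eqI[OF this] * show False by simp
  qed
qed

lemma test_fun_diff:
  assumes "test_fun \<Omega> f" "test_fun \<Omega> g"
  shows "test_fun \<Omega> (\<lambda>x. f x - g x)"
proof -
  have cl: "closed (tsupport f \<union> tsupport g)" by (auto simp: tsupport_def)
  have sub: "tsupport (\<lambda>x. f x - g x) \<subseteq> tsupport f \<union> tsupport g"
    unfolding tsupport_def[of "\<lambda>x. f x - g x"]
  proof (rule closure_minimal[OF subsetI cl])
    fix x assume "x \<in> {x. f x - g x \<noteq> 0}"
    then show "x \<in> tsupport f \<union> tsupport g"
      using notin_tsupport[of x f] notin_tsupport[of x g] by (cases "f x = 0") auto
  qed
  have "compact (tsupport f \<union> tsupport g)" using assms by (auto simp: test_fun_def)
  moreover have "closed (tsupport (\<lambda>x. f x - g x))" by (simp add: tsupport_def)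
  ultimately have "compact ((tsupport f \<union> tsupport g) \<inter> tsupport (\<lambda>x. f x - g x))"
    by (rule compact_Int_closed)
  with sub have "compact (tsupport (\<lambda>x. f x - g x))" by (simp only: Int_absorb1)
  then show ?thesis
    using assms order_trans[OF sub] unfolding test_fun_def by (simp add: smooth_fun_diff)
qed

lemma continuous_on_smooth_fun: "smooth_fun f \<Longrightarrow> continuous_on S f"
  by (simp add: continuous_at_imp_continuous_on differentiable_imp_continuous_within
      smooth_fun_differentiable)

section \<open>Smooth approximation of the indicator function of a box\<close>

text \<open>The polynomial factor makes this family closed under differentiation.\<close>
definition flat_exp :: "real poly \<Rightarrow> real \<Rightarrow> real" where
  "flat_exp q t = (if t > 0 then exp (- (1 / t)) * poly q (1 / t) else 0)"

text \<open>The free power \<open>n\<close> carries the induction over q: the factor y that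
  \<open>pCons\<close> puts in front of the remaining polynomial is absorbed into
  \<open>y ^ Suc n\<close>.\<close>

lemma poly_exp_tendsto_0:
  fixes q :: "real poly"
  shows "((\<lambda>y. y ^ n * poly q y / exp y) \<longlongrightarrow> 0) at_top"
proof (induction q arbitrary: n)
  case 0
  then show ?case by simp
next
  case (pCons a q)
  have "((\<lambda>y. a * (y ^ n / exp y) + y ^ Suc n * poly q y / exp y) \<longlongrightarrow> a * 0 + 0) at_top"
    by (intro tendsto_intros tendsto_power_div_exp_0 pCons)
  then show ?case by (simp add: algebra_simps add_divide_distrib)
qed

text \<open>Put y = 1/t, so that dy/dt = -y^2. The derivative of exp(-y) q(y) is then y^2 (q(y) -
  q'(y)) exp(-y), and \<open>[:0, 0, 1:]\<close> is the polynomial y^2. The only delicate point is t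
  = 0, where the two one-sided difference quotients are treated separately.\<close>

lemma has_real_derivative_flat_exp:
  "(flat_exp q has_real_derivative flat_exp ([:0, 0, 1:] * (q - pderiv q)) t) (at t)"
proof (cases "t = 0")
  case True
  have l: "((\<lambda>h. flat_exp q h / h) \<longlongrightarrow> 0) (at_left 0)"
    by (rule tendsto_eventually) (auto simp: flat_exp_def eventually_at_left_field intro: exI[of _ "-1"])
  \<comment> \<open>With y = 1/h, the difference quotient of \<open>flat_exp q\<close> at 0 for h >
    0 is y q(y) / exp y.\<close>
  have "((\<lambda>y. y ^ 1 * poly q y / exp y) \<longlongrightarrow> 0) at_top"
    by (rule poly_exp_tendsto_0)
  then have "((\<lambda>h. inverse h * poly q (inverse h) / exp (inverse h)) \<longlongrightarrow> 0) (at_right (0::real))"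
    using filterlim_compose[OF _ filterlim_inverse_at_top_right] by fastforce
  then have r: "((\<lambda>h. flat_exp q h / h) \<longlongrightarrow> 0) (at_right 0)"
    by (rule Lim_transform_eventually)
      (auto simp: flat_exp_def eventually_at_right_field exp_minus field_simps intro!: exI[of _ 1])
  have "((\<lambda>h. flat_exp q h / h) \<longlongrightarrow> 0) (at 0)"
    using l r by (simp add: filterlim_split_at)
  then show ?thesis
    using True unfolding has_field_derivative_iff by (simp add: flat_exp_def)
next
  case False
  show ?thesis
  proof (cases "t > 0")
    case True
    have r: "((\<lambda>t. 1 / t) has_real_derivative - (1 / t\<^sup>2)) (at t)"
      using DERIV_inverse[of t UNIV] False by (simp add: divide_inverse power2_eq_square)
    have "((\<lambda>t. exp (- (1 / t)) * poly q (1 / t)) has_real_derivative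
        exp (- (1 / t)) * - (- (1 / t\<^sup>2)) * poly q (1 / t)
          + poly (pderiv q) (1 / t) * - (1 / t\<^sup>2) * exp (- (1 / t))) (at t)"
      by (intro DERIV_mult DERIV_chain2[OF DERIV_exp DERIV_minus[OF r]] DERIV_chain2[OF poly_DERIV r])
    also have "exp (- (1 / t)) * - (- (1 / t\<^sup>2)) * poly q (1 / t)
          + poly (pderiv q) (1 / t) * - (1 / t\<^sup>2) * exp (- (1 / t))
        = flat_exp ([:0, 0, 1:] * (q - pderiv q)) t"
      using True by (simp add: flat_exp_def power2_eq_square algebra_simps)
    finally have "((\<lambda>t. exp (- (1 / t)) * poly q (1 / t)) has_real_derivative
        flat_exp ([:0, 0, 1:] * (q - pderiv q)) t) (at t)" .
    moreover have "eventually (\<lambda>s. s > 0) (nhds t)"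
      using True by (simp add: eventually_nhds_metric dist_real_def) (rule exI[of _ t], auto)
    ultimately show ?thesis
      by (subst DERIV_cong_ev[OF refl _ refl, where g="\<lambda>t. exp (- (1 / t)) * poly q (1 / t)"])
        (auto elim!: eventually_mono simp: flat_exp_def)
  next
    case neg: False
    with False have "t < 0" by simp
    then have "eventually (\<lambda>s. s < 0) (nhds t)"
      by (simp add: eventually_nhds_metric dist_real_def) (rule exI[of _ "-t"], auto)
    with \<open>t < 0\<close> show ?thesis
      by (subst DERIV_cong_ev[OF refl _ refl, where g="\<lambda>t. 0"])
        (auto elim!: eventually_mono simp: flat_exp_def)
  qed
qed

lemma has_derivative_flat_exp_coord:
  "((\<lambda>x. complex_of_real (flat_exp q (s * (x $ i - a)))) has_derivative
     (\<lambda>h. complex_of_real (flat_exp ([:0, 0, 1:] * (q - pderiv q)) (s * (x $ i - a)) * (s * h $ i)))) (at x)"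
proof -
  have "((\<lambda>x. s * (x $ i - a)) has_derivative (\<lambda>h. s * h $ i)) (at x)"
    by (auto intro!: derivative_eq_intros bounded_linear.has_derivative[OF bounded_linear_vec_nth])
  then have "((\<lambda>x. flat_exp q (s * (x $ i - a))) has_derivative
     (\<lambda>h. flat_exp ([:0, 0, 1:] * (q - pderiv q)) (s * (x $ i - a)) * (s * h $ i))) (at x)"
    using has_derivative_compose[OF _ has_real_derivative_flat_exp[unfolded has_field_derivative_def]]
    by fastforce
  then show ?thesis by (rule has_derivative_of_real)
qed

text \<open>A derivative changes the polynomial, so the generators must range over all q.
  Differentiating in direction j only contributes the constant s or 0, according to whether j is the
  coordinate i, and returns a generator.\<close>

lemma smooth_flat_exp_coord:
  fixes i :: "'n::finite"
  shows "smooth_fun (\<lambda>x::real^'n. complex_of_real (flat_exp q (s * (x $ i - a))))"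
proof -
  define G where "G = (\<lambda>(q, s, i, a) (x::real^'n). complex_of_real (flat_exp q (s * (x $ i - a))))"
  have GI: "(\<lambda>x. complex_of_real (flat_exp q (s * (x $ i - a)))) \<in> range G" for q s i a
    unfolding G_def by (rule image_eqI[of _ _ "(q, s, i, a)"]) auto
  show ?thesis
  proof (rule smooth_fun_alg[where S="range G"])
    show "(\<lambda>x. complex_of_real (flat_exp q (s * (x $ i - a)))) \<in> fun_alg (range G)"
      by (rule fun_alg.base[OF GI])
  next
    fix f x assume "f \<in> range G"
    then show "f differentiable (at x)"
      unfolding differentiable_def G_def using has_derivative_flat_exp_coord by fast
  next
    fix f j assume "f \<in> range G"
    then obtain q s i a where f: "f = (\<lambda>x. complex_of_real (flat_exp q (s * (x $ i - a))))"
      by (auto simp: G_def)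
    have "pd j f = (\<lambda>x. complex_of_real (s * axis j 1 $ i) *
        complex_of_real (flat_exp ([:0, 0, 1:] * (q - pderiv q)) (s * (x $ i - a))))"
      unfolding f by (rule ext, subst pd_eqI[OF has_derivative_flat_exp_coord])
        (simp add: mult_ac)
    then show "pd j f \<in> fun_alg (range G)"
      by (metis (no_types) fun_alg.mult[OF fun_alg.const fun_alg.base[OF GI]])
  qed
qed

text \<open>With the constant polynomial 1, \<open>flat_exp 1 t\<close> is exp(-1/t) for positive t.
  Each coordinate gets one factor vanishing left of a and one vanishing right of b. The dilation by
  k drives all factors to 1 inside the box without moving the zero set, so the bumps stay below the
  indicator they approximate.\<close>

definition box_bump :: "real^'n::finite \<Rightarrow> real^'n \<Rightarrow> nat \<Rightarrow> real^'n \<Rightarrow> real" where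
  "box_bump a b k x = (\<Prod>i\<in>UNIV. flat_exp 1 (real k * (x $ i - a $ i)) * flat_exp 1 (- real k * (x $ i - b $ i)))"

lemma flat_exp_nonpos: "t \<le> 0 \<Longrightarrow> flat_exp q t = 0"
  by (simp add: flat_exp_def)

lemma flat_exp_1_bounds: "0 \<le> flat_exp 1 t" "flat_exp 1 t \<le> 1"
  by (auto simp: flat_exp_def)

lemma box_bump_bounds: "0 \<le> box_bump a b k x" "box_bump a b k x \<le> 1"
  unfolding box_bump_def
  by (auto intro!: prod_nonneg prod_le_1 mult_le_one mult_nonneg_nonneg flat_exp_1_bounds)

lemma box_bump_eq_0: "x \<notin> box a b \<Longrightarrow> box_bump a b k x = 0"
proof -
  assume "x \<notin> box a b"
  then obtain i where "x $ i \<le> a $ i \<or> b $ i \<le> x $ i"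
    unfolding mem_box_cart by (meson not_less)
  then have "real k * (x $ i - a $ i) \<le> 0 \<or> - real k * (x $ i - b $ i) \<le> 0"
    by (auto simp: mult_le_0_iff)
  then have "flat_exp 1 (real k * (x $ i - a $ i)) * flat_exp 1 (- real k * (x $ i - b $ i)) = 0"
    using flat_exp_nonpos mult_zero_left mult_zero_right by metis
  then show ?thesis unfolding box_bump_def by (intro prod_zero) auto
qed

lemma test_fun_box_bump:
  assumes "cbox a b \<subseteq> \<Omega>"
  shows "test_fun \<Omega> (\<lambda>x. complex_of_real (box_bump a b k x))"
proof -
  have "tsupport (\<lambda>x. complex_of_real (box_bump a b k x)) \<subseteq> cbox a b"
    unfolding tsupport_def
    by (rule closure_minimal) (use box_bump_eq_0[of _ a b k] box_subset_cbox[of a b] in auto)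
  moreover from this have "compact (tsupport (\<lambda>x. complex_of_real (box_bump a b k x)))"
    using compact_Int_closed[OF compact_cbox closed_closure]
    unfolding tsupport_def by (metis Int_absorb1)
  moreover have "smooth_fun (\<lambda>x. complex_of_real (box_bump a b k x))"
    unfolding box_bump_def of_real_prod of_real_mult
    by (intro smooth_fun_prod smooth_fun_mult smooth_flat_exp_coord)
  ultimately show ?thesis using assms unfolding test_fun_def by blast
qed

lemma flat_exp_1_tendsto:
  assumes "t > 0"
  shows "(\<lambda>k. flat_exp 1 (real k * t)) \<longlonglongrightarrow> 1"
proof -
  have "(\<lambda>k. exp (- (inverse (real k) / t))) \<longlonglongrightarrow> exp (- (0 / t))"
    by (intro tendsto_intros lim_inverse_n) (use assms in auto)
  then have "(\<lambda>k. exp (- (inverse (real k) / t))) \<longlonglongrightarrow> 1" by simp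
  \<comment> \<open>The index k = 0 has to be skipped: there \<open>flat_exp 1 0\<close> is 0,
    whereas the formula gives 1 because \<open>inverse 0\<close> is 0.\<close>
  then show ?thesis
    by (rule Lim_transform_eventually)
      (use assms in \<open>auto simp: flat_exp_def field_simps intro!: eventually_sequentiallyI[of 1]\<close>)
qed

lemma box_bump_tendsto: "(\<lambda>k. box_bump a b k x) \<longlonglongrightarrow> indicator (box a b) x"
proof (cases "x \<in> box a b")
  case True
  have "(\<lambda>k. box_bump a b k x) \<longlonglongrightarrow> (\<Prod>i\<in>(UNIV::'a set). 1 * 1)"
    unfolding box_bump_def
  proof (intro tendsto_prod tendsto_mult)
    fix i
    show "(\<lambda>k. flat_exp 1 (real k * (x $ i - a $ i))) \<longlonglongrightarrow> 1"
      using True by (intro flat_exp_1_tendsto) (simp add: mem_box_cart)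
    show "(\<lambda>k. flat_exp 1 (- real k * (x $ i - b $ i))) \<longlonglongrightarrow> 1"
      using True flat_exp_1_tendsto[of "b $ i - x $ i"] by (simp add: mem_box_cart algebra_simps)
  qed
  with True show ?thesis by simp
next
  case False
  then show ?thesis by (simp add: box_bump_eq_0)
qed

section \<open>Square-integrable and bounded functions\<close>

text \<open>Components may lie in any Euclidean space, so that applying the equivalence twice treats
  matrix-valued functions entry by entry.\<close>

lemma borel_measurable_vec_iff:
  fixes f :: "'a \<Rightarrow> 'b::euclidean_space^'n::finite"
  shows "f \<in> borel_measurable M \<longleftrightarrow> (\<forall>i. (\<lambda>x. f x $ i) \<in> borel_measurable M)"
proof
  assume "f \<in> borel_measurable M"
  then have "(\<lambda>x. f x \<bullet> axis i b) \<in> borel_measurable M" for i b by measurable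
  then show "\<forall>i. (\<lambda>x. f x $ i) \<in> borel_measurable M"
    by (subst borel_measurable_euclidean_space) (simp add: inner_axis)
next
  assume *: "\<forall>i. (\<lambda>x. f x $ i) \<in> borel_measurable M"
  show "f \<in> borel_measurable M"
  proof (subst borel_measurable_euclidean_space, rule ballI)
    fix k :: "'b^'n" assume "k \<in> Basis"
    then obtain i b where k: "k = axis i b" by (auto simp: Basis_vec_def)
    from * have [measurable]: "(\<lambda>x. f x $ i) \<in> borel_measurable M" by blast
    show "(\<lambda>x. f x \<bullet> k) \<in> borel_measurable M" unfolding k inner_axis by measurable
  qed
qed

lemma L2_measurable: "L2 \<Omega> v \<Longrightarrow> v \<in> borel_measurable (lebesgue_on \<Omega>)"
  by (simp add: L2_def)

lemma L2_integrable_sq: "L2 \<Omega> v \<Longrightarrow> integrable (lebesgue_on \<Omega>) (\<lambda>x. (cmod (v x))\<^sup>2)"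
  by (simp add: L2_def)

lemma L2_integrable_mult:
  assumes "L2 \<Omega> v" "L2 \<Omega> w"
  shows "integrable (lebesgue_on \<Omega>) (\<lambda>x. v x * w x)"
proof (rule Bochner_Integration.integrable_bound)
  show "integrable (lebesgue_on \<Omega>) (\<lambda>x. (cmod (v x))\<^sup>2 + (cmod (w x))\<^sup>2)"
    by (intro Bochner_Integration.integrable_add L2_integrable_sq assms)
  note [measurable] = L2_measurable[OF assms(1)] L2_measurable[OF assms(2)]
  show "(\<lambda>x. v x * w x) \<in> borel_measurable (lebesgue_on \<Omega>)" by measurable
  have "s * t \<le> s\<^sup>2 + t\<^sup>2" if "0 \<le> s" "0 \<le> t" for s t :: real
    using sum_squares_bound[of s t] mult_nonneg_nonneg[OF that] by linarith
  then show "AE x in lebesgue_on \<Omega>. norm (v x * w x) \<le> norm ((cmod (v x))\<^sup>2 + (cmod (w x))\<^sup>2)"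
    by (simp add: norm_mult)
qed

lemma L2_cnj: "L2 \<Omega> v \<Longrightarrow> L2 \<Omega> (\<lambda>x. cnj (v x))"
  by (simp add: L2_def borel_measurable_complex_iff)

lemma L2_add:
  assumes "L2 \<Omega> v" "L2 \<Omega> w"
  shows "L2 \<Omega> (\<lambda>x. v x + w x)"
proof -
  note [measurable] = L2_measurable[OF assms(1)] L2_measurable[OF assms(2)]
  have "integrable (lebesgue_on \<Omega>) (\<lambda>x. (cmod (v x + w x))\<^sup>2)"
  proof (rule Bochner_Integration.integrable_bound)
    show "integrable (lebesgue_on \<Omega>) (\<lambda>x. 2 * (cmod (v x))\<^sup>2 + 2 * (cmod (w x))\<^sup>2)"
      by (intro Bochner_Integration.integrable_add integrable_mult_right L2_integrable_sq assms)
    have "(cmod (a + b))\<^sup>2 \<le> 2 * (cmod a)\<^sup>2 + 2 * (cmod b)\<^sup>2" for a b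
    proof -
      have "(cmod (a + b))\<^sup>2 \<le> (cmod a + cmod b)\<^sup>2"
        by (intro power_mono norm_triangle_ineq) auto
      also have "\<dots> \<le> 2 * (cmod a)\<^sup>2 + 2 * (cmod b)\<^sup>2"
        using sum_squares_bound[of "cmod a" "cmod b"] by (simp add: power2_sum)
      finally show ?thesis .
    qed
    then show "AE x in lebesgue_on \<Omega>. norm ((cmod (v x + w x))\<^sup>2)
        \<le> norm (2 * (cmod (v x))\<^sup>2 + 2 * (cmod (w x))\<^sup>2)" by simp
  qed measurable
  then show ?thesis by (simp add: L2_def)
qed

section \<open>Essentially bounded functions as multipliers\<close>

lemma Linf_measurable: "Linf \<Omega> g \<Longrightarrow> g \<in> borel_measurable (lebesgue_on \<Omega>)"
  by (simp add: Linf_def)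

lemma LinfI:
  "g \<in> borel_measurable (lebesgue_on \<Omega>) \<Longrightarrow> AE x in lebesgue_on \<Omega>. norm (g x) \<le> M \<Longrightarrow> Linf \<Omega> g"
  unfolding Linf_def by blast

lemma Linf_bound:
  assumes "Linf \<Omega> g"
  obtains M where "0 \<le> M" "AE x in lebesgue_on \<Omega>. norm (g x) \<le> M"
proof -
  from assms obtain M where "AE x in lebesgue_on \<Omega>. norm (g x) \<le> M"
    unfolding Linf_def by blast
  then have "AE x in lebesgue_on \<Omega>. norm (g x) \<le> max M 0" by (rule eventually_mono) simp
  then show ?thesis using that[of "max M 0"] by simp
qed

lemma L2_Linf_mult:
  fixes g :: "real^'n::finite \<Rightarrow> complex"
  assumes "Linf \<Omega> g" "L2 \<Omega> v"
  shows "L2 \<Omega> (\<lambda>x. g x * v x)"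
proof -
  obtain M where M: "0 \<le> M" "AE x in lebesgue_on \<Omega>. norm (g x) \<le> M"
    using Linf_bound[OF assms(1)] .
  note [measurable] = L2_measurable[OF assms(2)] Linf_measurable[OF assms(1)]
  have "integrable (lebesgue_on \<Omega>) (\<lambda>x. (cmod (g x * v x))\<^sup>2)"
  proof (rule Bochner_Integration.integrable_bound)
    show "integrable (lebesgue_on \<Omega>) (\<lambda>x. M\<^sup>2 * (cmod (v x))\<^sup>2)"
      by (intro integrable_mult_right L2_integrable_sq assms)
    from M(2) show "AE x in lebesgue_on \<Omega>. norm ((cmod (g x * v x))\<^sup>2) \<le> norm (M\<^sup>2 * (cmod (v x))\<^sup>2)"
      by (rule eventually_mono) (simp add: norm_mult power_mult_distrib mult_right_mono power_mono)
  qed measurable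
  then show ?thesis by (simp add: L2_def)
qed

lemma Linf_of_real:
  assumes "Linf \<Omega> (g :: real^'n::finite \<Rightarrow> real)"
  shows "Linf \<Omega> (\<lambda>x. complex_of_real (g x))"
proof -
  note [measurable] = Linf_measurable[OF assms]
  obtain M where "AE x in lebesgue_on \<Omega>. norm (g x) \<le> M" using Linf_bound[OF assms] by metis
  then show ?thesis by (intro LinfI[where M=M]) auto
qed

lemma Linf_nth:
  fixes g :: "real^'n::finite \<Rightarrow> 'b::euclidean_space^'m::finite"
  assumes "Linf \<Omega> g"
  shows "Linf \<Omega> (\<lambda>x. g x $ i)"
proof -
  obtain M where M: "AE x in lebesgue_on \<Omega>. norm (g x) \<le> M" using Linf_bound[OF assms] by metis
  show ?thesis
  proof (rule LinfI)
    show "(\<lambda>x. g x $ i) \<in> borel_measurable (lebesgue_on \<Omega>)"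
      using Linf_measurable[OF assms] borel_measurable_vec_iff by blast
    from M show "AE x in lebesgue_on \<Omega>. norm (g x $ i) \<le> M"
      by (rule eventually_mono) (meson Finite_Cartesian_Product.norm_nth_le order_trans)
  qed
qed

lemma L2_cmult: "L2 \<Omega> v \<Longrightarrow> L2 \<Omega> (\<lambda>x. k * v x)"
  by (rule L2_Linf_mult[OF LinfI[where M="cmod k"]]) auto

lemma L2_diff: "L2 \<Omega> v \<Longrightarrow> L2 \<Omega> w \<Longrightarrow> L2 \<Omega> (\<lambda>x. v x - w x)"
  using L2_add[OF _ L2_cmult[where k="-1"], of \<Omega> v w] by simp

lemma L2_sum: "(\<And>i. i \<in> I \<Longrightarrow> L2 \<Omega> (v i)) \<Longrightarrow> L2 \<Omega> (\<lambda>x. \<Sum>i\<in>I. v i x)"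
proof (induction I rule: infinite_finite_induct)
  case (insert i I)
  then show ?case using L2_add[of \<Omega> "v i" "\<lambda>x. \<Sum>i\<in>I. v i x"] by simp
qed (simp_all add: L2_def)

section \<open>Square-integrable vector fields, reduced to components\<close>

lemma norm_sq_vec: "(norm (v::complex^'n::finite))\<^sup>2 = (\<Sum>i\<in>UNIV. (cmod (v $ i))\<^sup>2)"
  by (simp add: norm_vec_def L2_set_def sum_nonneg)

lemma L2v_nth:
  assumes "L2v \<Omega> v"
  shows "L2 \<Omega> (\<lambda>x. v x $ i)"
proof -
  have m: "(\<lambda>x. v x $ i) \<in> borel_measurable (lebesgue_on \<Omega>)"
    using assms borel_measurable_vec_iff unfolding L2v_def by blast
  have "integrable (lebesgue_on \<Omega>) (\<lambda>x. (cmod (v x $ i))\<^sup>2)"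
  proof (rule Bochner_Integration.integrable_bound)
    show "integrable (lebesgue_on \<Omega>) (\<lambda>x. (norm (v x))\<^sup>2)" using assms by (simp add: L2v_def)
    show "AE x in lebesgue_on \<Omega>. norm ((cmod (v x $ i))\<^sup>2) \<le> norm ((norm (v x))\<^sup>2)"
      by (simp add: power_mono Finite_Cartesian_Product.norm_nth_le)
    note [measurable] = m
    show "(\<lambda>x. (cmod (v x $ i))\<^sup>2) \<in> borel_measurable (lebesgue_on \<Omega>)" by measurable
  qed
  with m show ?thesis by (simp add: L2_def)
qed

lemma L2v_iff: "L2v \<Omega> v \<longleftrightarrow> (\<forall>i. L2 \<Omega> (\<lambda>x. v x $ i))"
proof
  assume *: "\<forall>i. L2 \<Omega> (\<lambda>x. v x $ i)"
  show "L2v \<Omega> v" unfolding L2v_def norm_sq_vec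
  proof
    show "v \<in> borel_measurable (lebesgue_on \<Omega>)"
      using * L2_measurable borel_measurable_vec_iff by blast
    show "integrable (lebesgue_on \<Omega>) (\<lambda>x. \<Sum>i\<in>UNIV. (cmod (v x $ i))\<^sup>2)"
      using * by (intro Bochner_Integration.integrable_sum) (auto intro: L2_integrable_sq)
  qed
qed (blast intro: L2v_nth)

lemma L2v_diff: "L2v \<Omega> v \<Longrightarrow> L2v \<Omega> w \<Longrightarrow> L2v \<Omega> (\<lambda>x. v x - w x)"
  by (simp add: L2v_iff L2_diff)

lemma L2v_matrix_mult:
  assumes "Linf \<Omega> A" "L2v \<Omega> v"
  shows "L2v \<Omega> (\<lambda>x. A x *v v x)"
  unfolding L2v_iff matrix_vector_mult_def
  by (simp add: L2_sum L2_Linf_mult Linf_nth[OF Linf_nth[OF assms(1)]] L2v_nth[OF assms(2)])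

lemma integrable_cinner:
  assumes "L2v \<Omega> v" "L2v \<Omega> w"
  shows "integrable (lebesgue_on \<Omega>) (\<lambda>x. cinner (v x) (w x))"
  unfolding cinner_def
  by (intro Bochner_Integration.integrable_sum L2_integrable_mult L2v_nth assms L2_cnj)

section \<open>Convergence in the mean\<close>

lemma tendsto_0_squeeze:
  fixes f g :: "nat \<Rightarrow> real"
  assumes "\<And>k. 0 \<le> f k" "\<And>k. f k \<le> g k" "g \<longlonglongrightarrow> 0"
  shows "f \<longlonglongrightarrow> 0"
  by (rule tendsto_sandwich[OF always_eventually always_eventually tendsto_const assms(3)])
    (use assms(1,2) in blast)+

lemma L2nsq_nonneg: "0 \<le> L2nsq \<Omega> v"
  by (simp add: L2nsq_def)

text \<open>Cauchy-Schwarz, obtained from its version for nonnegative integrals of the moduli. The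
  squared form matches \<open>L2nsq\<close>, which is a squared norm.\<close>

lemma integral_mult_sq_le:
  assumes "L2 \<Omega> v" "L2 \<Omega> w"
  shows "(cmod (LINT x|lebesgue_on \<Omega>. v x * w x))\<^sup>2 \<le> L2nsq \<Omega> v * L2nsq \<Omega> w"
proof -
  let ?M = "lebesgue_on \<Omega>"
  note [measurable] = L2_measurable[OF assms(1)] L2_measurable[OF assms(2)]
  have i: "integrable ?M (\<lambda>x. cmod (v x) * cmod (w x))"
    using integrable_norm[OF L2_integrable_mult[OF assms]] by (simp add: norm_mult)
  define c where "c = (LINT x|?M. cmod (v x) * cmod (w x))"
  have c: "0 \<le> c" by (simp add: c_def)
  have "(\<integral>\<^sup>+x. ennreal (cmod (v x)) * ennreal (cmod (w x)) \<partial>?M)\<^sup>2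
      \<le> (\<integral>\<^sup>+x. (ennreal (cmod (v x)))\<^sup>2 \<partial>?M) * (\<integral>\<^sup>+x. (ennreal (cmod (w x)))\<^sup>2 \<partial>?M)"
    by (rule Cauchy_Schwarz_nn_integral) measurable
  also have "(\<integral>\<^sup>+x. ennreal (cmod (v x)) * ennreal (cmod (w x)) \<partial>?M) = ennreal c"
    unfolding c_def using nn_integral_eq_integral[OF i] by (simp add: ennreal_mult)
  also have "(\<integral>\<^sup>+x. (ennreal (cmod (v x)))\<^sup>2 \<partial>?M) = ennreal (L2nsq \<Omega> v)"
    unfolding L2nsq_def using nn_integral_eq_integral[OF L2_integrable_sq[OF assms(1)]]
    by (simp add: ennreal_power)
  also have "(\<integral>\<^sup>+x. (ennreal (cmod (w x)))\<^sup>2 \<partial>?M) = ennreal (L2nsq \<Omega> w)"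
    unfolding L2nsq_def using nn_integral_eq_integral[OF L2_integrable_sq[OF assms(2)]]
    by (simp add: ennreal_power)
  finally have "c\<^sup>2 \<le> L2nsq \<Omega> v * L2nsq \<Omega> w"
    using c L2nsq_nonneg[of \<Omega> v] L2nsq_nonneg[of \<Omega> w]
    by (simp add: ennreal_power ennreal_mult[symmetric] ennreal_le_iff)
  moreover have "cmod (LINT x|?M. v x * w x) \<le> c"
    unfolding c_def using integral_norm_bound[of ?M "\<lambda>x. v x * w x"] by (simp add: norm_mult)
  then have "(cmod (LINT x|?M. v x * w x))\<^sup>2 \<le> c\<^sup>2" by (intro power_mono) auto
  ultimately show ?thesis by linarith
qed

text \<open>Membership in \<open>L2\<close> is part of the notion because the integral of a
  non-integrable function is 0 by convention, so that a vanishing limit of \<open>L2nsq\<close>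
  alone would say nothing.\<close>

definition L2conv :: "(real^'n::finite) set \<Rightarrow> (nat \<Rightarrow> real^'n \<Rightarrow> complex) \<Rightarrow> (real^'n \<Rightarrow> complex) \<Rightarrow> bool" where
  "L2conv \<Omega> \<phi> u \<longleftrightarrow> (\<forall>k. L2 \<Omega> (\<phi> k)) \<and> L2 \<Omega> u \<and> (\<lambda>k. L2nsq \<Omega> (\<lambda>x. \<phi> k x - u x)) \<longlonglongrightarrow> 0"

lemma L2conv_const: "L2 \<Omega> u \<Longrightarrow> L2conv \<Omega> (\<lambda>k. u) u"
  by (simp add: L2conv_def L2nsq_def)

lemma L2conv_cnj: "L2conv \<Omega> \<phi> u \<Longrightarrow> L2conv \<Omega> (\<lambda>k x. cnj (\<phi> k x)) (\<lambda>x. cnj (u x))"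
  by (simp add: L2conv_def L2nsq_def L2_cnj complex_cnj_diff[symmetric] del: complex_cnj_diff)

lemma L2nsq_mono_AE:
  assumes "L2 \<Omega> v" "L2 \<Omega> w" "AE x in lebesgue_on \<Omega>. (cmod (v x))\<^sup>2 \<le> k * (cmod (w x))\<^sup>2"
  shows "L2nsq \<Omega> v \<le> k * L2nsq \<Omega> w"
proof -
  have "L2nsq \<Omega> v \<le> (LINT x|lebesgue_on \<Omega>. k * (cmod (w x))\<^sup>2)"
    unfolding L2nsq_def
    by (intro integral_mono_AE assms(3) L2_integrable_sq assms(1) integrable_mult_right assms(2))
  then show ?thesis by (simp add: L2nsq_def)
qed

lemma L2conv_Linf_mult:
  assumes "Linf \<Omega> g" "L2conv \<Omega> \<phi> u"
  shows "L2conv \<Omega> (\<lambda>k x. g x * \<phi> k x) (\<lambda>x. g x * u x)"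
proof -
  obtain M where M: "0 \<le> M" "AE x in lebesgue_on \<Omega>. norm (g x) \<le> M"
    using Linf_bound[OF assms(1)] .
  have L: "L2 \<Omega> (\<phi> k)" "L2 \<Omega> u" for k using assms(2) by (auto simp: L2conv_def)
  have "L2nsq \<Omega> (\<lambda>x. g x * \<phi> k x - g x * u x) \<le> M\<^sup>2 * L2nsq \<Omega> (\<lambda>x. \<phi> k x - u x)" for k
  proof (rule L2nsq_mono_AE)
    from M(2) show "AE x in lebesgue_on \<Omega>. (cmod (g x * \<phi> k x - g x * u x))\<^sup>2 \<le> M\<^sup>2 * (cmod (\<phi> k x - u x))\<^sup>2"
      by (rule eventually_mono)
        (simp add: norm_mult power_mult_distrib mult_right_mono power_mono right_diff_distrib[symmetric])
  qed (intro L2_diff L2_Linf_mult assms(1) L)+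
  moreover have "(\<lambda>k. M\<^sup>2 * L2nsq \<Omega> (\<lambda>x. \<phi> k x - u x)) \<longlonglongrightarrow> 0"
    using assms(2) by (intro tendsto_mult_right_zero) (simp add: L2conv_def)
  ultimately have "(\<lambda>k. L2nsq \<Omega> (\<lambda>x. g x * \<phi> k x - g x * u x)) \<longlonglongrightarrow> 0"
    by (rule tendsto_0_squeeze[OF L2nsq_nonneg])
  then show ?thesis using L assms(1) by (simp add: L2conv_def L2_Linf_mult)
qed

lemma L2conv_diff:
  assumes "L2conv \<Omega> \<phi> u" "L2conv \<Omega> \<psi> v"
  shows "L2conv \<Omega> (\<lambda>k x. \<phi> k x - \<psi> k x) (\<lambda>x. u x - v x)"
proof -
  have L: "L2 \<Omega> (\<phi> k)" "L2 \<Omega> u" "L2 \<Omega> (\<psi> k)" "L2 \<Omega> v" for k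
    using assms by (auto simp: L2conv_def)
  have "L2nsq \<Omega> (\<lambda>x. \<phi> k x - \<psi> k x - (u x - v x))
      \<le> 2 * L2nsq \<Omega> (\<lambda>x. \<phi> k x - u x) + 2 * L2nsq \<Omega> (\<lambda>x. \<psi> k x - v x)" for k
  proof -
    have *: "(cmod (a - b - (c - d)))\<^sup>2 \<le> 2 * (cmod (a - c))\<^sup>2 + 2 * (cmod (b - d))\<^sup>2" for a b c d
    proof -
      have "cmod (a - b - (c - d)) \<le> cmod (a - c) + cmod (b - d)"
        using norm_triangle_ineq4[of "a - c" "b - d"] by (simp add: algebra_simps)
      then have "(cmod (a - b - (c - d)))\<^sup>2 \<le> (cmod (a - c) + cmod (b - d))\<^sup>2"
        by (intro power_mono) auto
      also have "\<dots> \<le> 2 * (cmod (a - c))\<^sup>2 + 2 * (cmod (b - d))\<^sup>2"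
        using sum_squares_bound[of "cmod (a - c)" "cmod (b - d)"] by (simp add: power2_sum)
      finally show ?thesis .
    qed
    have i: "integrable (lebesgue_on \<Omega>) (\<lambda>x. 2 * (cmod (\<phi> k x - u x))\<^sup>2)"
      "integrable (lebesgue_on \<Omega>) (\<lambda>x. 2 * (cmod (\<psi> k x - v x))\<^sup>2)"
      by (intro integrable_mult_right L2_integrable_sq L2_diff L)+
    have "L2nsq \<Omega> (\<lambda>x. \<phi> k x - \<psi> k x - (u x - v x))
        \<le> (LINT x|lebesgue_on \<Omega>. 2 * (cmod (\<phi> k x - u x))\<^sup>2 + 2 * (cmod (\<psi> k x - v x))\<^sup>2)"
      unfolding L2nsq_def
      by (intro integral_mono Bochner_Integration.integrable_add i L2_integrable_sq L2_diff L *)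
    also have "\<dots> = 2 * L2nsq \<Omega> (\<lambda>x. \<phi> k x - u x) + 2 * L2nsq \<Omega> (\<lambda>x. \<psi> k x - v x)"
      by (subst Bochner_Integration.integral_add[OF i]) (simp add: L2nsq_def)
    finally show ?thesis .
  qed
  moreover have "(\<lambda>k. 2 * L2nsq \<Omega> (\<lambda>x. \<phi> k x - u x) + 2 * L2nsq \<Omega> (\<lambda>x. \<psi> k x - v x)) \<longlonglongrightarrow> 0"
    using assms by (intro tendsto_add_zero tendsto_mult_right_zero) (simp_all add: L2conv_def)
  ultimately have "(\<lambda>k. L2nsq \<Omega> (\<lambda>x. \<phi> k x - \<psi> k x - (u x - v x))) \<longlonglongrightarrow> 0"
    by (rule tendsto_0_squeeze[OF L2nsq_nonneg])
  then show ?thesis using L by (simp add: L2conv_def L2_diff)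
qed

text \<open>Write \<phi>\<psi> - uv = (\<phi> - u)(\<psi> - v) + (\<phi> - u)v + (\<psi> - v)u.
  Every term has a factor that tends to 0 in the mean, and Cauchy-Schwarz does the rest; the pairing
  is bilinear, conjugates being supplied by \<open>L2conv_cnj\<close>.\<close>

lemma L2conv_integral_mult:
  assumes "L2conv \<Omega> \<phi> u" "L2conv \<Omega> \<psi> v"
  shows "(\<lambda>k. LINT x|lebesgue_on \<Omega>. \<phi> k x * \<psi> k x) \<longlonglongrightarrow> (LINT x|lebesgue_on \<Omega>. u x * v x)"
proof -
  let ?I = "\<lambda>f g. LINT x|lebesgue_on \<Omega>. f x * g x :: complex"
  have L: "L2 \<Omega> (\<phi> k)" "L2 \<Omega> u" "L2 \<Omega> (\<psi> k)" "L2 \<Omega> v" for k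
    using assms by (auto simp: L2conv_def)
  \<comment> \<open>The number \<open>l\<close> is the limit of the squared norms of the second
    factor: 0 for \<psi> - v, and the constant squared norm for v and for u. Its existence replaces
    a separate boundedness argument.\<close>
  have small: "(\<lambda>k. ?I (\<lambda>x. \<phi> k x - u x) (\<chi>' k)) \<longlonglongrightarrow> 0"
    if c: "L2conv \<Omega> \<phi> u" and L': "\<And>k. L2 \<Omega> (\<chi>' k)" and b: "(\<lambda>k. L2nsq \<Omega> (\<chi>' k)) \<longlonglongrightarrow> l"
    for \<phi> u \<chi>' l
  proof -
    have "(\<lambda>k. L2nsq \<Omega> (\<lambda>x. \<phi> k x - u x) * L2nsq \<Omega> (\<chi>' k)) \<longlonglongrightarrow> 0 * l"
      using c b by (intro tendsto_mult) (simp_all add: L2conv_def)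
    moreover have "(cmod (?I (\<lambda>x. \<phi> k x - u x) (\<chi>' k)))\<^sup>2
        \<le> L2nsq \<Omega> (\<lambda>x. \<phi> k x - u x) * L2nsq \<Omega> (\<chi>' k)" for k
      using c by (intro integral_mult_sq_le L2_diff L') (simp_all add: L2conv_def)
    ultimately have "(\<lambda>k. (cmod (?I (\<lambda>x. \<phi> k x - u x) (\<chi>' k)))\<^sup>2) \<longlonglongrightarrow> 0"
      by (intro tendsto_0_squeeze[OF zero_le_power2]) simp_all
    then have "(\<lambda>k. sqrt ((cmod (?I (\<lambda>x. \<phi> k x - u x) (\<chi>' k)))\<^sup>2)) \<longlonglongrightarrow> sqrt 0"
      by (rule tendsto_real_sqrt)
    then show ?thesis by (simp add: tendsto_norm_zero_iff)
  qed
  have "?I (\<phi> k) (\<psi> k) = ?I (\<lambda>x. \<phi> k x - u x) (\<lambda>x. \<psi> k x - v x)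
      + ?I (\<lambda>x. \<phi> k x - u x) v + ?I (\<lambda>x. \<psi> k x - v x) u + ?I u v" for k
  proof -
    have "?I (\<phi> k) (\<psi> k) = (LINT x|lebesgue_on \<Omega>. (\<phi> k x - u x) * (\<psi> k x - v x)
      + (\<phi> k x - u x) * v x + (\<psi> k x - v x) * u x + u x * v x)"
      by (simp add: algebra_simps)
    also have "\<dots> = ?I (\<lambda>x. \<phi> k x - u x) (\<lambda>x. \<psi> k x - v x)
      + ?I (\<lambda>x. \<phi> k x - u x) v + ?I (\<lambda>x. \<psi> k x - v x) u + ?I u v"
      by (simp only: Bochner_Integration.integral_add Bochner_Integration.integrable_add
          L2_integrable_mult L2_diff L)
    finally show ?thesis .
  qed
  moreover have "(\<lambda>k. ?I (\<lambda>x. \<phi> k x - u x) (\<lambda>x. \<psi> k x - v x)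
      + ?I (\<lambda>x. \<phi> k x - u x) v + ?I (\<lambda>x. \<psi> k x - v x) u + ?I u v) \<longlonglongrightarrow> 0 + 0 + 0 + ?I u v"
  proof (intro tendsto_add tendsto_const)
    show "(\<lambda>k. ?I (\<lambda>x. \<phi> k x - u x) (\<lambda>x. \<psi> k x - v x)) \<longlonglongrightarrow> 0"
      using assms(2) by (intro small[OF assms(1), of "\<lambda>k x. \<psi> k x - v x" 0] L2_diff L) (simp add: L2conv_def)
    show "(\<lambda>k. ?I (\<lambda>x. \<phi> k x - u x) v) \<longlonglongrightarrow> 0"
      by (rule small[OF assms(1) L(4) tendsto_const])
    show "(\<lambda>k. ?I (\<lambda>x. \<psi> k x - v x) u) \<longlonglongrightarrow> 0"
      by (rule small[OF assms(2) L(2) tendsto_const])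
  qed
  ultimately show ?thesis by simp
qed

section \<open>Test functions determine square-integrable functions\<close>

lemma L2_test_fun:
  assumes "open \<Omega>" "test_fun \<Omega> \<psi>"
  shows "L2 \<Omega> \<psi>"
proof -
  have \<Omega>: "\<Omega> \<in> sets lebesgue" using assms(1) by (simp add: lmeasurable_open borel_open)
  have K: "compact (tsupport \<psi>)" "tsupport \<psi> \<subseteq> \<Omega>" and sm: "smooth_fun \<psi>"
    using assms(2) by (auto simp: test_fun_def)
  have c: "continuous_on S \<psi>" for S by (rule continuous_on_smooth_fun[OF sm])
  have m[measurable]: "\<psi> \<in> borel_measurable (lebesgue_on \<Omega>)"
    by (rule continuous_imp_measurable_on_sets_lebesgue[OF c \<Omega>])
  have "bounded (\<psi> ` tsupport \<psi>)"
    using compact_continuous_image[OF c K(1)] compact_imp_bounded by blast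
  then obtain B where B: "\<And>x. x \<in> tsupport \<psi> \<Longrightarrow> cmod (\<psi> x) \<le> B"
    unfolding bounded_iff by blast
  have KL: "tsupport \<psi> \<in> lmeasurable" using K(1) by (rule lmeasurable_compact)
  have "integrable (lebesgue_on \<Omega>) (\<lambda>x. (cmod (\<psi> x))\<^sup>2)"
  proof (rule integrableI_bounded_set[where A="tsupport \<psi>" and B="B\<^sup>2"])
    show "tsupport \<psi> \<in> sets (lebesgue_on \<Omega>)"
      using KL K(2) \<Omega> by (simp add: sets_restrict_space_iff)
    show "emeasure (lebesgue_on \<Omega>) (tsupport \<psi>) < \<infinity>"
      using fmeasurableD2[OF KL] K(2) \<Omega> emeasure_restrict_space[of \<Omega> lebesgue "tsupport \<psi>"]
      by (simp del: emeasure_completion add: less_top)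
    show "AE x in lebesgue_on \<Omega>. x \<in> tsupport \<psi> \<longrightarrow> norm ((cmod (\<psi> x))\<^sup>2) \<le> B\<^sup>2"
      using B by (intro AE_I2) (simp add: power_mono)
    show "AE x in lebesgue_on \<Omega>. x \<notin> tsupport \<psi> \<longrightarrow> (cmod (\<psi> x))\<^sup>2 = 0"
      using notin_tsupport[of _ \<psi>] by (intro AE_I2) simp
  qed measurable
  with m show ?thesis by (simp add: L2_def)
qed

lemma L2_indicator_box:
  fixes a b :: "real^'n::finite"
  assumes "open \<Omega>"
  shows "L2 \<Omega> (\<lambda>x. indicator (box a b) x)"
proof -
  have \<Omega>: "\<Omega> \<in> sets lebesgue" using assms by (simp add: borel_open)
  have S: "box a b \<inter> \<Omega> \<in> sets (lebesgue_on \<Omega>)"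
    using \<Omega> by (auto simp: sets_restrict_space)
  have "emeasure lebesgue (box a b \<inter> \<Omega>) \<le> emeasure lebesgue (box a b)"
    by (rule emeasure_mono) auto
  also have "\<dots> < \<infinity>" using lmeasurable_box[of a b] by (simp add: fmeasurable_def)
  finally have fin: "emeasure (lebesgue_on \<Omega>) (box a b \<inter> \<Omega>) < \<infinity>"
    using \<Omega> by (simp add: emeasure_restrict_space)
  have "integrable (lebesgue_on \<Omega>) (indicator (box a b \<inter> \<Omega>) :: _ \<Rightarrow> real)"
    using S fin by (rule integrable_real_indicator)
  also have "integrable (lebesgue_on \<Omega>) (indicator (box a b \<inter> \<Omega>) :: _ \<Rightarrow> real)
      \<longleftrightarrow> integrable (lebesgue_on \<Omega>) (indicator (box a b) :: _ \<Rightarrow> real)"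
    by (rule Bochner_Integration.integrable_cong) (auto simp: indicator_def)
  finally have i: "integrable (lebesgue_on \<Omega>) (indicator (box a b) :: _ \<Rightarrow> real)" .
  have 1: "(cmod (indicator (box a b) x))\<^sup>2 = indicator (box a b) x" for x :: "real^'n"
    by (simp add: indicator_def)
  have 2: "complex_of_real (indicator (box a b) x) = indicator (box a b) x" for x :: "real^'n"
    by (simp add: indicator_def)
  have "(\<lambda>x. complex_of_real (indicator (box a b) x)) \<in> borel_measurable (lebesgue_on \<Omega>)"
    by (intro borel_measurable_integrable integrable_of_real i)
  with i show ?thesis unfolding L2_def 1 unfolding 2 by blast
qed

text \<open>The bumps carry the orthogonality over to the indicator of the box. The conclusion uses
  the gauge integral over a closed box, the form in which the differentiation theorem
  \<open>integrable_ccontinuous_explicit\<close> speaks of averages.\<close>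

lemma integral_box_eq_0:
  fixes h :: "real^'n::finite \<Rightarrow> complex"
  assumes "open \<Omega>" "L2 \<Omega> h"
    and orth: "\<And>\<psi>. test_fun \<Omega> \<psi> \<Longrightarrow> (LINT x|lebesgue_on \<Omega>. h x * \<psi> x) = 0"
    and sub: "cbox a b \<subseteq> \<Omega>"
  shows "integral (cbox a b) h = 0"
proof -
  let ?M = "lebesgue_on \<Omega>"
  have \<Omega>: "\<Omega> \<in> sets lebesgue" using assms(1) by (simp add: borel_open)
  have i: "integrable ?M (\<lambda>x. h x * indicator (box a b) x)"
    by (rule L2_integrable_mult[OF assms(2) L2_indicator_box[OF assms(1)]])
  have "(\<lambda>k. LINT x|?M. h x * complex_of_real (box_bump a b k x))
      \<longlonglongrightarrow> (LINT x|?M. h x * indicator (box a b) x)"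
  \<comment> \<open>The bumps lie between 0 and the indicator, so the modulus of the limit itself
    dominates; it is integrable as a product of two \<open>L2\<close> functions.\<close>
  proof (rule integral_dominated_convergence[where w="\<lambda>x. norm (h x * indicator (box a b) x)"])
    show "AE x in ?M. (\<lambda>k. h x * complex_of_real (box_bump a b k x)) \<longlonglongrightarrow> h x * indicator (box a b) x"
    proof (intro AE_I2 tendsto_mult tendsto_const)
      fix x
      have "(\<lambda>k. complex_of_real (box_bump a b k x)) \<longlonglongrightarrow> complex_of_real (indicator (box a b) x)"
        by (intro tendsto_of_real box_bump_tendsto)
      then show "(\<lambda>k. complex_of_real (box_bump a b k x)) \<longlonglongrightarrow> indicator (box a b) x"
        by (cases "x \<in> box a b") simp_all
    qed
    have "norm (h x * complex_of_real (box_bump a b k x)) \<le> norm (h x * indicator (box a b) x)" for k x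
      using box_bump_bounds[of a b k x] box_bump_eq_0[of x a b k]
      by (cases "x \<in> box a b") (simp_all add: norm_mult mult_left_le)
    then show "AE x in ?M. norm (h x * complex_of_real (box_bump a b k x)) \<le> norm (h x * indicator (box a b) x)" for k
      by simp
    show "(\<lambda>x. h x * complex_of_real (box_bump a b k x)) \<in> borel_measurable ?M" for k
      by (intro borel_measurable_integrable L2_integrable_mult assms(2)
          L2_test_fun[OF assms(1) test_fun_box_bump[OF sub]])
  qed (use i in \<open>auto intro: borel_measurable_integrable integrable_norm\<close>)
  then have "(\<lambda>k. 0) \<longlonglongrightarrow> (LINT x|?M. h x * indicator (box a b) x)"
    by (simp add: orth[OF test_fun_box_bump[OF sub]])
  then have "0 = (LINT x|?M. h x * indicator (box a b) x)"
    using LIMSEQ_const_iff by blast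
  also have "\<dots> = integral \<Omega> (\<lambda>x. h x * indicator (box a b) x)"
    by (rule lebesgue_integral_eq_integral[OF i \<Omega>])
  also have "\<dots> = integral \<Omega> (\<lambda>x. if x \<in> box a b then h x else 0)"
    by (rule Henstock_Kurzweil_Integration.integral_cong) simp
  also have "\<dots> = integral (box a b \<inter> \<Omega>) h"
    by (rule Henstock_Kurzweil_Integration.integral_restrict_Int)
  also have "box a b \<inter> \<Omega> = box a b" using sub box_subset_cbox[of a b] by blast
  finally show ?thesis by (simp add: integral_open_interval)
qed

text \<open>The fundamental lemma of the calculus of variations. At almost every point h is the
  limit of its averages over shrinking cubes, and those averages are 0 as soon as the cubes fit into
  \<Omega>.\<close>

lemma AE_eq_0_if_orthogonal_test_fun:
  fixes h :: "real^'n::finite \<Rightarrow> complex"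
  assumes "open \<Omega>" "L2 \<Omega> h"
    and orth: "\<And>\<psi>. test_fun \<Omega> \<psi> \<Longrightarrow> (LINT x|lebesgue_on \<Omega>. h x * \<psi> x) = 0"
  shows "AE x in lebesgue_on \<Omega>. h x = 0"
proof -
  have \<Omega>: "\<Omega> \<in> sets lebesgue" using assms(1) by (simp add: borel_open)
  have box: "negligible {x \<in> box a b. h x \<noteq> 0}" if ab: "box a b \<subseteq> \<Omega>" for a b
  proof -
    \<comment> \<open>The differentiation theorem wants integrability over every closed box of the
      whole space, while h is controlled only inside \<Omega>; the truncation to one open box
      provides this.\<close>
    define F where "F = (\<lambda>x. if x \<in> box a b then h x else 0)"
    have "integrable (lebesgue_on \<Omega>) (\<lambda>x. h x * indicator (box a b) x)"
      by (rule L2_integrable_mult[OF assms(2) L2_indicator_box[OF assms(1)]])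
    then have "integrable lebesgue (\<lambda>x. if x \<in> \<Omega> then h x * indicator (box a b) x else 0)"
      by (simp add: Lebesgue_Measure.integrable_restrict_UNIV[OF \<Omega>])
    also have "(\<lambda>x. if x \<in> \<Omega> then h x * indicator (box a b) x else 0) = F"
      using ab by (auto simp: F_def indicator_def fun_eq_iff)
    finally have "F integrable_on UNIV"
      by (metis integrable_on_lebesgue)
    then have "F integrable_on cbox c d" for c d
      by (rule integrable_on_subcbox) simp
    then obtain N where N: "negligible N"
      "\<And>x e. \<lbrakk>x \<notin> N; 0 < e\<rbrakk> \<Longrightarrow> \<exists>d>0. \<forall>h. 0 < h \<and> h < d \<longrightarrow>
         norm (integral (cbox x (x + h *\<^sub>R One)) F /\<^sub>R h ^ DIM(real^'n) - F x) < e"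
      using integrable_ccontinuous_explicit[of F] by metis
    have "h x = 0" if x: "x \<in> box a b" "x \<notin> N" for x
    proof (rule ccontr)
      assume "h x \<noteq> 0"
      \<comment> \<open>With the tolerance |h x| a vanishing average is already contradictory: it
        would give |h x| < |h x|. It remains to find a cube with corner x and side below d that
        stays in the open box.\<close>
      then obtain d where d: "d > 0" "\<And>h'. 0 < h' \<and> h' < d \<Longrightarrow>
          norm (integral (cbox x (x + h' *\<^sub>R One)) F /\<^sub>R h' ^ DIM(real^'n) - F x) < norm (h x)"
        using N(2)[OF x(2), of "norm (h x)"] by auto
      have "((\<lambda>t. x + t *\<^sub>R One) \<longlongrightarrow> x + 0 *\<^sub>R One) (at_right 0)"
        by (intro tendsto_intros)
      then have "((\<lambda>t. x + t *\<^sub>R One) \<longlongrightarrow> x) (at_right (0::real))" by simp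
      then have "eventually (\<lambda>t. x + t *\<^sub>R One \<in> box a b) (at_right (0::real))"
        by (rule topological_tendstoD[OF _ open_box x(1)])
      moreover have "eventually (\<lambda>t. 0 < t \<and> t < d) (at_right (0::real))"
        using d(1) by (auto simp: eventually_at_right_field)
      ultimately have "eventually (\<lambda>t. x + t *\<^sub>R One \<in> box a b \<and> 0 < t \<and> t < d) (at_right (0::real))"
        by (rule eventually_conj)
      then obtain t where t: "x + t *\<^sub>R One \<in> box a b" "0 < t" "t < d"
        using eventually_happens'[OF trivial_limit_at_right_real] by blast
      have sub: "cbox x (x + t *\<^sub>R One) \<subseteq> box a b"
      proof
        fix y assume y: "y \<in> cbox x (x + t *\<^sub>R One)"
        show "y \<in> box a b"
          unfolding mem_box
        proof (intro ballI conjI)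
          fix i :: "real^'n" assume i: "i \<in> Basis"
          have "x \<bullet> i \<le> y \<bullet> i" "y \<bullet> i \<le> (x + t *\<^sub>R One) \<bullet> i"
            using y i unfolding mem_box by blast+
          moreover have "a \<bullet> i < x \<bullet> i" "(x + t *\<^sub>R One) \<bullet> i < b \<bullet> i"
            using x(1) t(1) i unfolding mem_box by blast+
          ultimately show "a \<bullet> i < y \<bullet> i" "y \<bullet> i < b \<bullet> i" by linarith+
        qed
      qed
      have "integral (cbox x (x + t *\<^sub>R One)) F = integral (cbox x (x + t *\<^sub>R One)) h"
        by (rule Henstock_Kurzweil_Integration.integral_cong) (use sub in \<open>auto simp: F_def\<close>)
      also have "\<dots> = 0"
        by (rule integral_box_eq_0[OF assms(1,2) orth]) (use sub ab in auto)
      finally show False using d(2)[of t] t x(1) by (simp add: F_def)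
    qed
    then have "{x \<in> box a b. h x \<noteq> 0} \<subseteq> N" by blast
    then show ?thesis using N(1) negligible_subset by blast
  qed
  \<comment> \<open>Countably many open boxes exhaust \<Omega>, so the null sets found box by box
    add up to a null set.\<close>
  obtain D where D: "countable D" "D \<subseteq> Pow \<Omega>" "\<And>X. X \<in> D \<Longrightarrow> \<exists>a b. X = box a b" "\<Union>D = \<Omega>"
    using open_countable_Union_open_box[OF assms(1)] by metis
  have "negligible (\<Union>X\<in>D. {x \<in> X. h x \<noteq> 0})"
  proof (rule negligible_countable_Union)
    show "countable ((\<lambda>X. {x \<in> X. h x \<noteq> 0}) ` D)" using D(1) by simp
    show "negligible Y" if Y: "Y \<in> (\<lambda>X. {x \<in> X. h x \<noteq> 0}) ` D" for Y
    proof -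
      obtain X where X: "X \<in> D" "Y = {x \<in> X. h x \<noteq> 0}" using Y by blast
      then obtain a b where "X = box a b" using D(3) by blast
      with X D(2) box[of a b] show ?thesis by blast
    qed
  qed
  also have "(\<Union>X\<in>D. {x \<in> X. h x \<noteq> 0}) = {x \<in> \<Omega>. h x \<noteq> 0}" using D(4) by blast
  finally have "AE x in lebesgue. x \<in> \<Omega> \<longrightarrow> h x = 0"
    unfolding eventually_ae_filter_negligible by blast
  then show ?thesis using \<Omega> by (simp add: AE_restrict_space_iff)
qed

lemma weak_grad_unique:
  assumes "open \<Omega>" "weak_grad \<Omega> u G" "weak_grad \<Omega> u H" "L2v \<Omega> G" "L2v \<Omega> H"
  shows "AE x in lebesgue_on \<Omega>. G x = H x"
proof -
  have "AE x in lebesgue_on \<Omega>. G x $ i - H x $ i = 0" for i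
  proof (rule AE_eq_0_if_orthogonal_test_fun[OF assms(1)])
    show "L2 \<Omega> (\<lambda>x. G x $ i - H x $ i)" by (intro L2_diff L2v_nth assms)
    fix \<psi> assume \<psi>: "test_fun \<Omega> \<psi>"
    have i: "integrable (lebesgue_on \<Omega>) (\<lambda>x. G x $ i * \<psi> x)"
      "integrable (lebesgue_on \<Omega>) (\<lambda>x. H x $ i * \<psi> x)"
      by (intro L2_integrable_mult L2v_nth assms(4,5) L2_test_fun[OF assms(1) \<psi>])+
    have "- (LINT x|lebesgue_on \<Omega>. G x $ i * \<psi> x) = - (LINT x|lebesgue_on \<Omega>. H x $ i * \<psi> x)"
      using assms(2,3)[unfolded weak_grad_def, rule_format, OF \<psi>] by simp
    then show "(LINT x|lebesgue_on \<Omega>. (G x $ i - H x $ i) * \<psi> x) = 0"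
      by (simp add: left_diff_distrib Bochner_Integration.integral_diff[OF i])
  qed
  then have "AE x in lebesgue_on \<Omega>. \<forall>i. G x $ i - H x $ i = 0"
    by (simp add: AE_all_countable)
  then show ?thesis by (rule eventually_mono) (simp add: vec_eq_iff)
qed

section \<open>Integration by parts in the closure of the test functions\<close>

lemma L2vnsq_nth_le:
  assumes "L2v \<Omega> v"
  shows "L2nsq \<Omega> (\<lambda>x. v x $ i) \<le> L2vnsq \<Omega> v"
  unfolding L2nsq_def L2vnsq_def
proof (rule integral_mono)
  show "integrable (lebesgue_on \<Omega>) (\<lambda>x. (cmod (v x $ i))\<^sup>2)"
    by (rule L2_integrable_sq[OF L2v_nth[OF assms]])
  show "integrable (lebesgue_on \<Omega>) (\<lambda>x. (norm (v x))\<^sup>2)" using assms by (simp add: L2v_def)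
qed (simp add: power_mono Finite_Cartesian_Product.norm_nth_le)

text \<open>The sequence is tied to one given representative G of the weak gradient, and convergence
  is required for each component, so that the scalar limit lemmas apply directly.\<close>

definition test_approx where
  "test_approx \<Omega> \<phi> u G \<longleftrightarrow> (\<forall>k. test_fun \<Omega> (\<phi> k)) \<and> L2conv \<Omega> \<phi> u
     \<and> (\<forall>i. L2conv \<Omega> (\<lambda>k. pd i (\<phi> k)) (\<lambda>x. G x $ i))"

lemma H10_test_approx:
  assumes "open \<Omega>" "H10 \<Omega> u" "weak_grad \<Omega> u gu" "L2v \<Omega> gu"
  obtains \<phi> where "test_approx \<Omega> \<phi> u gu"
proof -
  from assms(2) obtain G \<phi> where u: "L2 \<Omega> u" and G: "L2v \<Omega> G" "weak_grad \<Omega> u G"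
    and \<phi>: "\<And>k. test_fun \<Omega> (\<phi> k)"
    and lim: "(\<lambda>k. L2nsq \<Omega> (\<lambda>x. \<phi> k x - u x) + L2vnsq \<Omega> (\<lambda>x. cgrad (\<phi> k) x - G x)) \<longlonglongrightarrow> 0"
    unfolding H10_def by blast
  have L: "L2 \<Omega> (\<phi> k)" "L2 \<Omega> (pd i (\<phi> k))" for i k
    by (intro L2_test_fun[OF assms(1)] \<phi> test_fun_pd)+
  have LG: "L2v \<Omega> (\<lambda>x. cgrad (\<phi> k) x - G x)" for k
    using L(2) by (intro L2v_diff G) (simp add: L2v_iff cgrad_def)
  have pos: "0 \<le> L2vnsq \<Omega> v" for v :: "real^'a \<Rightarrow> complex^'a" by (simp add: L2vnsq_def)
  have ae: "AE x in lebesgue_on \<Omega>. gu x = G x"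
    by (rule weak_grad_unique[OF assms(1,3) G(2) assms(4) G(1)])
  have "(\<lambda>k. L2nsq \<Omega> (\<lambda>x. \<phi> k x - u x)) \<longlonglongrightarrow> 0"
    by (rule tendsto_0_squeeze[OF L2nsq_nonneg _ lim]) (simp add: pos)
  moreover have "(\<lambda>k. L2nsq \<Omega> (\<lambda>x. pd i (\<phi> k) x - gu x $ i)) \<longlonglongrightarrow> 0" for i
  proof (rule tendsto_0_squeeze[OF L2nsq_nonneg _ lim])
    fix k
    have "L2nsq \<Omega> (\<lambda>x. pd i (\<phi> k) x - gu x $ i) \<le> 1 * L2nsq \<Omega> (\<lambda>x. (cgrad (\<phi> k) x - G x) $ i)"
    proof (rule L2nsq_mono_AE)
      from ae show "AE x in lebesgue_on \<Omega>. (cmod (pd i (\<phi> k) x - gu x $ i))\<^sup>2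
          \<le> 1 * (cmod ((cgrad (\<phi> k) x - G x) $ i))\<^sup>2"
        by (rule eventually_mono) (simp add: cgrad_def)
    qed (rule L2_diff[OF L(2) L2v_nth[OF assms(4)]] L2v_nth[OF LG])+
    also have "\<dots> \<le> L2vnsq \<Omega> (\<lambda>x. cgrad (\<phi> k) x - G x)"
      using L2vnsq_nth_le[OF LG] by simp
    finally show "L2nsq \<Omega> (\<lambda>x. pd i (\<phi> k) x - gu x $ i)
        \<le> L2nsq \<Omega> (\<lambda>x. \<phi> k x - u x) + L2vnsq \<Omega> (\<lambda>x. cgrad (\<phi> k) x - G x)"
      using L2nsq_nonneg[of \<Omega> "\<lambda>x. \<phi> k x - u x"] by linarith
  qed
  ultimately have "test_approx \<Omega> \<phi> u gu"
    by (simp add: test_approx_def L2conv_def \<phi> L u L2v_nth[OF assms(4)])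
  then show ?thesis by (rule that)
qed

lemma test_approx_diff:
  assumes "test_approx \<Omega> \<phi> u G" "test_approx \<Omega> \<psi> v H"
  shows "test_approx \<Omega> (\<lambda>k x. \<phi> k x - \<psi> k x) (\<lambda>x. u x - v x) (\<lambda>x. G x - H x)"
proof -
  have "pd i (\<lambda>x. \<phi> k x - \<psi> k x) = (\<lambda>x. pd i (\<phi> k) x - pd i (\<psi> k) x)" for i k
  proof
    fix x
    have d: "\<phi> k differentiable at x" "\<psi> k differentiable at x"
      using assms by (auto simp: test_approx_def test_fun_def smooth_fun_differentiable)
    show "pd i (\<lambda>x. \<phi> k x - \<psi> k x) x = pd i (\<phi> k) x - pd i (\<psi> k) x"
      using pd_eqI[OF has_derivative_diff[OF d[unfolded frechet_derivative_works]], of i]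
      by (simp add: pd_def)
  qed
  then show ?thesis
    using assms by (simp add: test_approx_def test_fun_diff L2conv_diff)
qed

text \<open>For each approximant this is the definition of the weak divergence. Both sides are
  continuous under mean convergence of the function and of its partial derivatives, so the identity
  survives in the limit.\<close>

lemma weak_div_test_approx:
  assumes "test_approx \<Omega> \<phi> e G" "weak_div \<Omega> q dq" "L2v \<Omega> q" "L2 \<Omega> dq"
  shows "(LINT x|lebesgue_on \<Omega>. (\<Sum>i\<in>UNIV. q x $ i * G x $ i)) = - (LINT x|lebesgue_on \<Omega>. dq x * e x)"
proof -
  let ?M = "lebesgue_on \<Omega>"
  have c: "L2conv \<Omega> \<phi> e" "L2conv \<Omega> (\<lambda>k. pd i (\<phi> k)) (\<lambda>x. G x $ i)" for i
    using assms(1) by (auto simp: test_approx_def)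
  have L: "L2 \<Omega> (\<lambda>x. q x $ i)" "L2 \<Omega> (pd i (\<phi> k))" "L2 \<Omega> (\<lambda>x. G x $ i)" for i k
    using c(2) assms(3) by (auto simp: L2conv_def L2v_nth)
  have s: "(LINT x|?M. (\<Sum>i\<in>UNIV. q x $ i * g i x)) = (\<Sum>i\<in>UNIV. LINT x|?M. q x $ i * g i x)"
    if "\<And>i. L2 \<Omega> (g i)" for g
    by (rule Bochner_Integration.integral_sum) (rule L2_integrable_mult[OF L(1) that])
  have "(\<lambda>k. \<Sum>i\<in>UNIV. LINT x|?M. q x $ i * pd i (\<phi> k) x) \<longlonglongrightarrow> (\<Sum>i\<in>UNIV. LINT x|?M. q x $ i * G x $ i)"
    by (intro tendsto_sum L2conv_integral_mult c L2conv_const L)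
  moreover have "(\<lambda>k. - (LINT x|?M. dq x * \<phi> k x)) \<longlonglongrightarrow> - (LINT x|?M. dq x * e x)"
    by (intro tendsto_minus L2conv_integral_mult c L2conv_const assms)
  moreover have "(\<Sum>i\<in>UNIV. LINT x|?M. q x $ i * pd i (\<phi> k) x) = - (LINT x|?M. dq x * \<phi> k x)" for k
  proof -
    have "test_fun \<Omega> (\<phi> k)" using assms(1) by (simp add: test_approx_def)
    then have "(LINT x|?M. (\<Sum>i\<in>UNIV. q x $ i * pd i (\<phi> k) x)) = - (LINT x|?M. dq x * \<phi> k x)"
      using assms(2) unfolding weak_div_def by blast
    then show ?thesis using s[of "\<lambda>i. pd i (\<phi> k)", OF L(2)] by simp
  qed
  ultimately have "(\<Sum>i\<in>UNIV. LINT x|?M. q x $ i * G x $ i) = - (LINT x|?M. dq x * e x)"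
    by (simp only: LIMSEQ_unique)
  with s[of "\<lambda>i x. G x $ i", OF L(3)] show ?thesis by simp
qed

text \<open>The weak divergence is defined by a bilinear pairing, but \<open>cinner g q\<close>
  contains the conjugate of q. Testing with conj \<psi> and conjugating the whole identity transfers
  the divergence to conj q.\<close>

lemma weak_div_cnj:
  assumes "weak_div \<Omega> q dq"
  shows "weak_div \<Omega> (\<lambda>x. \<chi> i. cnj (q x $ i)) (\<lambda>x. cnj (dq x))"
  unfolding weak_div_def
proof (intro allI impI)
  fix \<psi> assume \<psi>: "test_fun \<Omega> \<psi>"
  then have d: "\<And>x. \<psi> differentiable (at x)" by (simp add: test_fun_def smooth_fun_differentiable)
  have "(LINT x|lebesgue_on \<Omega>. (\<Sum>i\<in>UNIV. q x $ i * pd i (\<lambda>x. cnj (\<psi> x)) x))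
      = - (LINT x|lebesgue_on \<Omega>. dq x * cnj (\<psi> x))"
    using assms test_fun_cnj[OF \<psi>] unfolding weak_div_def by blast
  then have "(LINT x|lebesgue_on \<Omega>. cnj (\<Sum>i\<in>UNIV. q x $ i * pd i (\<lambda>x. cnj (\<psi> x)) x))
      = - (LINT x|lebesgue_on \<Omega>. cnj (dq x * cnj (\<psi> x)))"
    by (simp only: Bochner_Integration.integral_cnj complex_cnj_minus)
  then show "(LINT x|lebesgue_on \<Omega>. (\<Sum>i\<in>UNIV. (\<chi> i. cnj (q x $ i)) $ i * pd i \<psi> x))
      = - (LINT x|lebesgue_on \<Omega>. cnj (dq x) * \<psi> x)"
    by (simp add: pd_cnj[OF d])
qed

text \<open>For a test function \<phi>, the product of \<phi> and its conjugate is a test function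
  and can be inserted into the definition of div b. Since b is real, the product rule produces
  exactly the left-hand integrand. Only afterwards is the limit taken, which avoids a product rule
  for weak derivatives.\<close>

lemma advection_test_approx:
  assumes "open \<Omega>" "test_approx \<Omega> \<phi> e G" "Linf \<Omega> b" "Linf \<Omega> divb"
    and divb: "weak_div \<Omega> (\<lambda>x. cvec (b x)) (\<lambda>x. complex_of_real (divb x))"
  shows "(LINT x|lebesgue_on \<Omega>. e x * cnj (bdot (b x) (G x)) + cnj (e x) * bdot (b x) (G x))
       = - (LINT x|lebesgue_on \<Omega>. complex_of_real (divb x) * e x * cnj (e x))"
proof -
  let ?M = "lebesgue_on \<Omega>"
  have c: "L2conv \<Omega> \<phi> e" "L2conv \<Omega> (\<lambda>k. pd i (\<phi> k)) (\<lambda>x. G x $ i)" and \<phi>: "test_fun \<Omega> (\<phi> k)" for i k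
    using assms(2) by (auto simp: test_approx_def)
  have L: "L2 \<Omega> (\<phi> k)" "L2 \<Omega> e" "L2 \<Omega> (pd i (\<phi> k))" "L2 \<Omega> (\<lambda>x. G x $ i)" for i k
    using c by (auto simp: L2conv_def)
  have bi: "Linf \<Omega> (\<lambda>x. complex_of_real (b x $ i))" for i
    by (intro Linf_of_real Linf_nth assms(3))
  \<comment> \<open>Splitting into scalar integrals isolates pairings of two mean-convergent
    factors, one of them multiplied by the bounded coefficient b_i.\<close>
  let ?T = "\<lambda>\<phi> g. \<Sum>i\<in>UNIV. (LINT x|?M. \<phi> x * cnj (complex_of_real (b x $ i) * g i x))
      + (LINT x|?M. cnj (\<phi> x) * (complex_of_real (b x $ i) * g i x))"
  have T: "(LINT x|?M. (\<Sum>i\<in>UNIV. \<phi> x * cnj (complex_of_real (b x $ i) * g i x)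
      + cnj (\<phi> x) * (complex_of_real (b x $ i) * g i x))) = ?T \<phi> g"
    if "L2 \<Omega> \<phi>" "\<And>i. L2 \<Omega> (g i)" for \<phi> g
  proof -
    have i: "integrable ?M (\<lambda>x. \<phi> x * cnj (complex_of_real (b x $ i) * g i x))"
      "integrable ?M (\<lambda>x. cnj (\<phi> x) * (complex_of_real (b x $ i) * g i x))" for i
      by (intro L2_integrable_mult L2_cnj that L2_Linf_mult bi)+
    show ?thesis
      by (subst Bochner_Integration.integral_sum)
        (simp_all only: Bochner_Integration.integrable_add i Bochner_Integration.integral_add)
  qed
  have "(\<lambda>k. ?T (\<phi> k) (\<lambda>i. pd i (\<phi> k))) \<longlonglongrightarrow> ?T e (\<lambda>i x. G x $ i)"
    by (intro tendsto_sum tendsto_add L2conv_integral_mult L2conv_cnj L2conv_Linf_mult c bi)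
  moreover have "?T (\<phi> k) (\<lambda>i. pd i (\<phi> k)) = - (LINT x|?M. complex_of_real (divb x) * \<phi> k x * cnj (\<phi> k x))" for k
  proof -
    have sm: "smooth_fun (\<phi> k)" and d: "\<And>x. \<phi> k differentiable at x"
      using \<phi>[of k] by (auto simp: test_fun_def smooth_fun_differentiable)
    note dc = smooth_fun_differentiable[OF smooth_fun_cnj[OF sm]]
    have "test_fun \<Omega> (\<lambda>x. \<phi> k x * cnj (\<phi> k x))"
      by (intro test_fun_mult \<phi> smooth_fun_cnj sm)
    then have "(LINT x|?M. (\<Sum>i\<in>UNIV. cvec (b x) $ i * pd i (\<lambda>x. \<phi> k x * cnj (\<phi> k x)) x))
        = - (LINT x|?M. complex_of_real (divb x) * (\<phi> k x * cnj (\<phi> k x)))"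
      using divb unfolding weak_div_def by blast
    also have "(\<lambda>x. \<Sum>i\<in>UNIV. cvec (b x) $ i * pd i (\<lambda>x. \<phi> k x * cnj (\<phi> k x)) x)
        = (\<lambda>x. \<Sum>i\<in>UNIV. \<phi> k x * cnj (complex_of_real (b x $ i) * pd i (\<phi> k) x)
            + cnj (\<phi> k x) * (complex_of_real (b x $ i) * pd i (\<phi> k) x))"
      by (simp add: pd_mult[OF d dc] pd_cnj[OF d] cvec_def algebra_simps)
    finally show ?thesis using T[of "\<phi> k" "\<lambda>i. pd i (\<phi> k)", OF L(1) L(3)] by (simp add: mult.assoc)
  qed
  moreover have "(\<lambda>k. - (LINT x|?M. complex_of_real (divb x) * \<phi> k x * cnj (\<phi> k x)))
      \<longlonglongrightarrow> - (LINT x|?M. complex_of_real (divb x) * e x * cnj (e x))"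
    by (intro tendsto_minus L2conv_integral_mult L2conv_cnj L2conv_Linf_mult c Linf_of_real assms)
  ultimately have "?T e (\<lambda>i x. G x $ i) = - (LINT x|?M. complex_of_real (divb x) * e x * cnj (e x))"
    by (simp only: LIMSEQ_unique)
  then show ?thesis
    using T[of e "\<lambda>i x. G x $ i", OF L(2,4)]
    by (simp add: bdot_def sum.distrib sum_distrib_left)
qed

section \<open>The coefficient matrix and its inverse\<close>

lemma Re_cinner: "Re (cinner v w) = v \<bullet> w"
  by (simp add: cinner_def inner_vec_def inner_complex_def)

lemma cnj_cinner: "cnj (cinner v w) = cinner w v"
  by (simp add: cinner_def mult.commute)

lemma cinner_diff_left: "cinner (v - w) z = cinner v z - cinner w z"
  by (simp add: cinner_def left_diff_distrib sum_subtractf)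

lemma cinner_diff_right: "cinner z (v - w) = cinner z v - cinner z w"
  by (simp add: cinner_def right_diff_distrib sum_subtractf)

lemma cinner_hermitian:
  assumes "\<forall>i j. A $ i $ j = cnj (A $ j $ i)"
  shows "cinner (A *v v) w = cinner v (A *v w)"
proof -
  have "cinner (A *v v) w = (\<Sum>i\<in>UNIV. \<Sum>j\<in>UNIV. A $ i $ j * v $ j * cnj (w $ i))"
    by (simp add: cinner_def matrix_vector_mult_def sum_distrib_right)
  also have "\<dots> = (\<Sum>j\<in>UNIV. \<Sum>i\<in>UNIV. A $ i $ j * v $ j * cnj (w $ i))"
    by (rule sum.swap)
  also have "\<dots> = (\<Sum>j\<in>UNIV. \<Sum>i\<in>UNIV. v $ j * cnj (A $ j $ i * w $ i))"
  proof (intro sum.cong refl)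
    fix i j
    have "A $ i $ j = cnj (A $ j $ i)" using assms by blast
    then show "A $ i $ j * v $ j * cnj (w $ i) = v $ j * cnj (A $ j $ i * w $ i)"
      by (simp add: mult_ac)
  qed
  also have "\<dots> = cinner v (A *v w)"
    by (simp add: cinner_def matrix_vector_mult_def sum_distrib_left)
  finally show ?thesis .
qed

text \<open>Let E be the part of a ball on which the inequality for v fails, and test the integrated
  inequality with v cut off to E. The integrand \<alpha>|v|^2 - Q is strictly positive on E, yet its
  integral over E is at most 0; hence E is a null set.\<close>

lemma pointwise_elliptic_vector:
  fixes A :: "real^'n::finite \<Rightarrow> complex^'n^'n"
  assumes "open \<Omega>" "Linf \<Omega> A"
    and ell: "\<And>\<phi>. L2v \<Omega> \<phi> \<Longrightarrow> \<alpha> * L2vnsq \<Omega> \<phi> \<le> mwnsq \<Omega> A \<phi>"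
  shows "AE x in lebesgue_on \<Omega>. \<alpha> * (norm v)\<^sup>2 \<le> Re (cinner (A x *v v) v)"
proof -
  let ?M = "lebesgue_on \<Omega>"
  have \<Omega>: "\<Omega> \<in> sets lebesgue" using assms(1) by (simp add: borel_open)
  define Q where "Q = (\<lambda>x. Re (cinner (A x *v v) v))"
  have mA: "(\<lambda>x. A x $ i $ j) \<in> borel_measurable ?M" for i j
    by (rule Linf_measurable[OF Linf_nth[OF Linf_nth[OF assms(2)]]])
  have "(\<lambda>x. cinner (A x *v v) v) \<in> borel_measurable ?M"
    unfolding cinner_def matrix_vector_mult_def vec_lambda_beta
    by (intro borel_measurable_sum borel_measurable_times borel_measurable_const mA)
  then have Q: "Q \<in> borel_measurable ?M"
    unfolding Q_def by (simp add: borel_measurable_complex_iff)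
  have "AE x in ?M. \<not> (x \<in> ball 0 (real n) \<and> Q x < \<alpha> * (norm v)\<^sup>2)" for n
  proof -
    \<comment> \<open>The ball gives E finite measure, without which the cut-off vector need not be
      square-integrable. All of \<Omega> is recovered at the end by letting n vary.\<close>
    define E where "E = {x \<in> \<Omega>. x \<in> ball 0 (real n) \<and> Q x < \<alpha> * (norm v)\<^sup>2}"
    have E: "E \<in> sets ?M"
    proof -
      have "{x \<in> space ?M. Q x < \<alpha> * (norm v)\<^sup>2} \<in> sets ?M" using Q by measurable
      moreover have "ball 0 (real n) \<inter> \<Omega> \<in> sets ?M" using \<Omega> by (auto simp: sets_restrict_space)
      moreover have "E = {x \<in> space ?M. Q x < \<alpha> * (norm v)\<^sup>2} \<inter> (ball 0 (real n) \<inter> \<Omega>)"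
        using \<Omega> by (auto simp: E_def space_restrict_space)
      ultimately show ?thesis by (simp add: sets.Int)
    qed
    have EL: "E \<in> sets lebesgue" "E \<subseteq> \<Omega>" using E \<Omega> by (auto simp: sets_restrict_space_iff)
    have "emeasure lebesgue E \<le> emeasure lebesgue (ball 0 (real n) :: (real^'n) set)"
      by (rule emeasure_mono) (auto simp: E_def)
    also have "\<dots> < \<infinity>"
      using fmeasurableD2[OF lmeasurable_ball[of "0::real^'n" "real n"]] by (simp del: emeasure_completion add: less_top)
    finally have fin: "emeasure ?M E < \<infinity>"
      using emeasure_restrict_space[of \<Omega> lebesgue E] EL \<Omega> by (simp del: emeasure_completion)
    define \<phi> where "\<phi> = (\<lambda>x. indicator E x *\<^sub>R v)"
    have iE: "integrable ?M (indicator E :: _ \<Rightarrow> real)" using E fin by (rule integrable_real_indicator)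
    have n\<phi>: "(norm (\<phi> x))\<^sup>2 = indicator E x * (norm v)\<^sup>2" for x
      by (simp add: \<phi>_def indicator_def)
    have \<phi>: "L2v \<Omega> \<phi>"
      unfolding L2v_def n\<phi>
    proof
      show "\<phi> \<in> borel_measurable ?M" unfolding \<phi>_def using E by measurable
      show "integrable ?M (\<lambda>x. indicator E x * (norm v)\<^sup>2)" using iE by simp
    qed
    have c: "cinner (A x *v \<phi> x) (\<phi> x) = indicator E x *\<^sub>R cinner (A x *v v) v" for x
      by (simp add: \<phi>_def indicator_def cinner_def)
    have iQ: "integrable ?M (\<lambda>x. indicator E x * Q x)"
      using integrable_Re[OF integrable_cinner[OF L2v_matrix_mult[OF assms(2) \<phi>] \<phi>]]
      by (simp add: c Q_def)
    have i: "integrable ?M (\<lambda>x. indicator E x * (\<alpha> * (norm v)\<^sup>2) - indicator E x * Q x)"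
      using iE iQ by (intro Bochner_Integration.integrable_diff integrable_mult_left) auto
    have nn: "0 \<le> indicator E x * (\<alpha> * (norm v)\<^sup>2) - indicator E x * Q x" for x
      by (simp add: indicator_def E_def)
    have "(LINT x|?M. indicator E x * (\<alpha> * (norm v)\<^sup>2) - indicator E x * Q x)
        = \<alpha> * L2vnsq \<Omega> \<phi> - mwnsq \<Omega> A \<phi>"
    proof -
      have "(LINT x|?M. indicator E x * (\<alpha> * (norm v)\<^sup>2)) = \<alpha> * L2vnsq \<Omega> \<phi>"
        by (simp add: L2vnsq_def n\<phi>)
      moreover have "(LINT x|?M. indicator E x * Q x) = mwnsq \<Omega> A \<phi>"
        unfolding mwnsq_def
        using integral_Re[OF integrable_cinner[OF L2v_matrix_mult[OF assms(2) \<phi>] \<phi>]]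
        by (simp add: c Q_def)
      moreover have "integrable ?M (\<lambda>x. indicator E x * (\<alpha> * (norm v)\<^sup>2))"
        using iE by simp
      ultimately show ?thesis using iQ by (simp add: Bochner_Integration.integral_diff)
    qed
    moreover have "0 \<le> (LINT x|?M. indicator E x * (\<alpha> * (norm v)\<^sup>2) - indicator E x * Q x)"
      by (intro integral_nonneg_AE AE_I2 nn)
    ultimately have "(LINT x|?M. indicator E x * (\<alpha> * (norm v)\<^sup>2) - indicator E x * Q x) = 0"
      using ell[OF \<phi>] by linarith
    then have "AE x in ?M. indicator E x * (\<alpha> * (norm v)\<^sup>2) - indicator E x * Q x = 0"
      using integral_nonneg_eq_0_iff_AE[OF i] nn by simp
    moreover have "AE x in ?M. x \<in> \<Omega>" using \<Omega> by (intro AE_I2) (simp add: space_restrict_space)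
    ultimately show ?thesis
    proof eventually_elim
      case (elim x)
      then show ?case by (auto simp: E_def)
    qed
  qed
  then have "AE x in ?M. \<forall>n. \<not> (x \<in> ball 0 (real n) \<and> Q x < \<alpha> * (norm v)\<^sup>2)"
    unfolding AE_all_countable by blast
  then show ?thesis
  proof (rule eventually_mono)
    fix x assume *: "\<forall>n. \<not> (x \<in> ball 0 (real n) \<and> Q x < \<alpha> * (norm v)\<^sup>2)"
    obtain n where "norm x < real n" using reals_Archimedean2 by blast
    then have "x \<in> ball 0 (real n)" by simp
    with * show "\<alpha> * (norm v)\<^sup>2 \<le> Re (cinner (A x *v v) v)"
      unfolding Q_def using not_less by blast
  qed
qed

text \<open>The exceptional null set may depend on v, so v is first confined to a countable dense
  set. For fixed x the vectors violating the inequality form an open set, which would meet the dense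
  set if it were nonempty.\<close>

lemma pointwise_elliptic:
  fixes A :: "real^'n::finite \<Rightarrow> complex^'n^'n"
  assumes "open \<Omega>" "Linf \<Omega> A"
    and ell: "\<And>\<phi>. L2v \<Omega> \<phi> \<Longrightarrow> \<alpha> * L2vnsq \<Omega> \<phi> \<le> mwnsq \<Omega> A \<phi>"
  shows "AE x in lebesgue_on \<Omega>. \<forall>v. \<alpha> * (norm v)\<^sup>2 \<le> Re (cinner (A x *v v) v)"
proof -
  obtain D :: "(complex^'n) set" where D: "countable D" "\<And>X. open X \<Longrightarrow> X \<noteq> {} \<Longrightarrow> \<exists>d\<in>D. d \<in> X"
    using countable_dense_setE by blast
  have "AE x in lebesgue_on \<Omega>. \<forall>v\<in>D. \<alpha> * (norm v)\<^sup>2 \<le> Re (cinner (A x *v v) v)"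
    using D(1) pointwise_elliptic_vector[OF assms] by (simp add: AE_ball_countable)
  then show ?thesis
  proof (rule eventually_mono)
    fix x assume *: "\<forall>v\<in>D. \<alpha> * (norm v)\<^sup>2 \<le> Re (cinner (A x *v v) v)"
    have "continuous_on UNIV (\<lambda>v. Re (cinner (A x *v v) v))"
      unfolding cinner_def matrix_vector_mult_def vec_lambda_beta by (intro continuous_intros)
    then have "open {v. Re (cinner (A x *v v) v) < \<alpha> * (norm v)\<^sup>2}"
      by (rule open_Collect_less) (intro continuous_intros)
    with D(2) * have "{v. Re (cinner (A x *v v) v) < \<alpha> * (norm v)\<^sup>2} = {}"
      by (metis (no_types, lifting) mem_Collect_eq not_less)
    then show "\<forall>v. \<alpha> * (norm v)\<^sup>2 \<le> Re (cinner (A x *v v) v)"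
      by (simp add: not_less)
  qed
qed

section \<open>Existence, bound and measurability of the inverse matrix\<close>

lemma elliptic_invertible:
  fixes B :: "complex^'n::finite^'n"
  assumes "0 < \<alpha>" "\<forall>v. \<alpha> * (norm v)\<^sup>2 \<le> Re (cinner (B *v v) v)"
  shows "invertible B"
proof -
  have "inj ((*v) B)"
  proof (rule injI)
    fix v w assume "B *v v = B *v w"
    then have "B *v (v - w) = 0" by (simp add: matrix_vector_mult_diff_distrib)
    then have "\<alpha> * (norm (v - w))\<^sup>2 \<le> 0"
      using assms(2)[rule_format, of "v - w"] by (simp add: Re_cinner)
    with assms(1) show "v = w" by (simp add: mult_le_0_iff)
  qed
  then obtain C where "C ** B = mat 1"
    using matrix_left_invertible_injective[of B] by blast
  then show ?thesis
    unfolding invertible_def using matrix_left_right_inverse by blast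
qed

lemma matrix_inv_mult_vector:
  fixes B :: "complex^'n::finite^'n"
  assumes "invertible B"
  shows "matrix_inv B *v (B *v v) = v" "B *v (matrix_inv B *v v) = v"
proof -
  have "B ** matrix_inv B = mat 1 \<and> matrix_inv B ** B = mat 1"
    using someI_ex[OF assms[unfolded invertible_def]] unfolding matrix_inv_def .
  then show "matrix_inv B *v (B *v v) = v" "B *v (matrix_inv B *v v) = v"
    by (simp_all add: matrix_vector_mul_assoc matrix_vector_mul_lid)
qed

text \<open>Let w be column j of the inverse, so that B w is a unit vector. Ellipticity at w and
  Cauchy-Schwarz give \<alpha>|w|^2 \<le> |w|.\<close>

lemma elliptic_matrix_inv_nth_le:
  fixes B :: "complex^'n::finite^'n"
  assumes "0 < \<alpha>" "\<forall>v. \<alpha> * (norm v)\<^sup>2 \<le> Re (cinner (B *v v) v)"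
  shows "cmod (matrix_inv B $ i $ j) \<le> 1 / \<alpha>"
proof -
  define w where "w = matrix_inv B *v axis j 1"
  have Bw: "B *v w = axis j 1"
    unfolding w_def by (rule matrix_inv_mult_vector(2)[OF elliptic_invertible[OF assms]])
  have "\<alpha> * (norm w)\<^sup>2 \<le> axis j 1 \<bullet> w"
    using assms(2)[rule_format, of w] by (simp add: Re_cinner Bw)
  also have "\<dots> \<le> norm (axis j (1::complex)) * norm w" by (rule norm_cauchy_schwarz)
  also have "\<dots> = norm w" by simp
  finally have "(\<alpha> * norm w) * norm w \<le> 1 * norm w" by (simp add: power2_eq_square)
  then have "norm w \<le> 1 / \<alpha>"
    using assms(1) by (cases "norm w = 0") (simp_all add: field_simps)
  moreover have "matrix_inv B $ i $ j = w $ i"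
    by (simp add: w_def matrix_vector_mult_def axis_def if_distrib[of "(*) _"] cong: if_cong)
  ultimately show ?thesis
    using Finite_Cartesian_Product.norm_nth_le[of w i] by simp
qed

lemma borel_measurable_det:
  fixes B :: "'a \<Rightarrow> complex^'n::finite^'n"
  assumes "\<And>i j. (\<lambda>x. B x $ i $ j) \<in> borel_measurable M"
  shows "(\<lambda>x. det (B x)) \<in> borel_measurable M"
  unfolding det_def
  by (intro borel_measurable_sum borel_measurable_times borel_measurable_prod borel_measurable_const assms)

text \<open>Cramer's rule; on singular matrices the library's \<^const>\<open>matrix_inv\<close> is one unspecified constant.\<close>
lemma matrix_inv_nth:
  fixes B :: "complex^'n::finite^'n"
  shows "matrix_inv B $ i $ j =
    (if det B \<noteq> 0 then det (\<chi> k l. if l = i then axis j 1 $ k else B $ k $ l) / det B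
     else (SOME C::complex^'n^'n. False) $ i $ j)"
proof (cases "det B = 0")
  case True
  then have "\<not> invertible B" by (simp add: invertible_det_nz)
  then have "matrix_inv B = (SOME C. False)"
    unfolding matrix_inv_def invertible_def by (metis (no_types, lifting))
  with True show ?thesis by simp
next
  case False
  then have "B *v (matrix_inv B *v axis j 1) = axis j 1"
    by (intro matrix_inv_mult_vector(2)) (simp add: invertible_det_nz)
  then have "matrix_inv B *v axis j 1 =
      (\<chi> k. det (\<chi> i l. if l = k then axis j 1 $ i else B $ i $ l) / det B)"
    using cramer[OF False] by blast
  moreover have "matrix_inv B $ i $ j = (matrix_inv B *v axis j 1) $ i"
    by (simp add: matrix_vector_mult_def axis_def if_distrib[of "(*) _"] cong: if_cong)
  ultimately show ?thesis using False by simp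
qed

text \<open>Measurability comes from the explicit entry formula \<open>matrix_inv_nth\<close>, which
  also covers the points where A is singular: there the entries are constant. The norm bound is
  simply the sum of the bounds 1/\<alpha> for the single entries.\<close>

lemma Linf_matrix_inv:
  fixes A :: "real^'n::finite \<Rightarrow> complex^'n^'n"
  assumes "Linf \<Omega> A" "0 < \<alpha>"
    and ell: "AE x in lebesgue_on \<Omega>. \<forall>v. \<alpha> * (norm v)\<^sup>2 \<le> Re (cinner (A x *v v) v)"
  shows "Linf \<Omega> (\<lambda>x. matrix_inv (A x))"
proof (rule LinfI)
  let ?M = "lebesgue_on \<Omega>"
  have mA: "(\<lambda>x. A x $ i $ j) \<in> borel_measurable ?M" for i j
    by (rule Linf_measurable[OF Linf_nth[OF Linf_nth[OF assms(1)]]])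
  have "(\<lambda>x. matrix_inv (A x) $ i $ j) \<in> borel_measurable ?M" for i j
  proof -
    have 1: "(\<lambda>x. det (A x)) \<in> borel_measurable ?M" by (rule borel_measurable_det[OF mA])
    have 2: "(\<lambda>x. det (\<chi> k l. if l = i then axis j 1 $ k else A x $ k $ l)) \<in> borel_measurable ?M"
    proof (rule borel_measurable_det)
      fix k l
      show "(\<lambda>x. (\<chi> k l. if l = i then axis j 1 $ k else A x $ k $ l) $ k $ l) \<in> borel_measurable ?M"
        using mA by (cases "l = i") simp_all
    qed
    show ?thesis
      unfolding matrix_inv_nth using 1 2 by measurable
  qed
  then show "(\<lambda>x. matrix_inv (A x)) \<in> borel_measurable ?M"
    by (simp add: borel_measurable_vec_iff)
  from ell show "AE x in ?M. norm (matrix_inv (A x)) \<le> (\<Sum>i\<in>(UNIV::'n set). \<Sum>j\<in>(UNIV::'n set). 1 / \<alpha>)"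
  proof (rule eventually_mono)
    fix x assume *: "\<forall>v. \<alpha> * (norm v)\<^sup>2 \<le> Re (cinner (A x *v v) v)"
    have "norm (matrix_inv (A x)) \<le> (\<Sum>i\<in>UNIV. norm (matrix_inv (A x) $ i))"
      by (simp add: norm_vec_def L2_set_le_sum)
    also have "\<dots> \<le> (\<Sum>i\<in>UNIV. \<Sum>j\<in>UNIV. cmod (matrix_inv (A x) $ i $ j))"
      by (intro sum_mono) (subst norm_vec_def, simp add: L2_set_le_sum)
    also have "\<dots> \<le> (\<Sum>i\<in>(UNIV::'n set). \<Sum>j\<in>(UNIV::'n set). 1 / \<alpha>)"
      by (intro sum_mono elliptic_matrix_inv_nth_le[OF assms(2) *])
    finally show "norm (matrix_inv (A x)) \<le> (\<Sum>i\<in>(UNIV::'n set). \<Sum>j\<in>(UNIV::'n set). 1 / \<alpha>)" .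
  qed
qed

section \<open>The error identity\<close>

lemma L2_bdot:
  assumes "Linf \<Omega> b" "L2v \<Omega> g"
  shows "L2 \<Omega> (\<lambda>x. bdot (b x) (g x))"
  unfolding bdot_def
  by (intro L2_sum L2_Linf_mult Linf_of_real Linf_nth assms(1) L2v_nth assms(2))

lemma Linf_diff:
  fixes g h :: "real^'n::finite \<Rightarrow> real"
  assumes "Linf \<Omega> g" "Linf \<Omega> h"
  shows "Linf \<Omega> (\<lambda>x. g x - h x)"
proof -
  obtain M where M: "AE x in lebesgue_on \<Omega>. norm (g x) \<le> M" using Linf_bound[OF assms(1)] by metis
  obtain N where N: "AE x in lebesgue_on \<Omega>. norm (h x) \<le> N" using Linf_bound[OF assms(2)] by metis
  note [measurable] = Linf_measurable[OF assms(1)] Linf_measurable[OF assms(2)]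
  show ?thesis
  proof (rule LinfI)
    from M N show "AE x in lebesgue_on \<Omega>. norm (g x - h x) \<le> M + N"
      by eventually_elim (meson add_mono norm_triangle_ineq4 order_trans)
  qed measurable
qed

lemma Linf_inverse:
  fixes c :: "real^'n::finite \<Rightarrow> real"
  assumes "Linf \<Omega> c" "0 < c0" "AE x in lebesgue_on \<Omega>. c0 \<le> c x"
  shows "Linf \<Omega> (\<lambda>x. 1 / c x)"
proof (rule LinfI)
  note [measurable] = Linf_measurable[OF assms(1)]
  show "(\<lambda>x. 1 / c x) \<in> borel_measurable (lebesgue_on \<Omega>)" by measurable
  from assms(3) show "AE x in lebesgue_on \<Omega>. norm (1 / c x) \<le> 1 / c0"
    by (rule eventually_mono) (use assms(2) in \<open>simp add: frac_le\<close>)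
qed

text \<open>The weight 1/c cancels the factor c in both cross terms, and c being real makes them
  conjugate to each other.\<close>

lemma weighted_square_expand:
  fixes c :: real and e d :: complex
  assumes "c \<noteq> 0"
  shows "of_real (1 / c) * (of_real c * e + d) * cnj (of_real c * e + d)
    = of_real c * e * cnj e + (e * cnj d + cnj e * d) + of_real (1 / c) * d * cnj d"
  using assms by (simp add: field_simps)

text \<open>Applying the inverse to B g - q leaves g minus the inverse applied to q. In the
  remaining pairing with B g, the Hermitian B is moved to the other side, where it cancels its
  inverse; the inverse itself need not be shown Hermitian.\<close>

lemma inverse_square_expand:
  fixes B :: "complex^'n::finite^'n"
  assumes "\<forall>i j. B $ i $ j = cnj (B $ j $ i)" "invertible B"
  shows "cinner (matrix_inv B *v (B *v g - q)) (B *v g - q)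
    = cinner (B *v g) g - (cinner g q + cinner q g) + cinner (matrix_inv B *v q) q"
proof -
  have 1: "matrix_inv B *v (B *v g - q) = g - matrix_inv B *v q"
    by (simp add: matrix_vector_mult_diff_distrib matrix_inv_mult_vector[OF assms(2)])
  have 2: "cinner (matrix_inv B *v q) (B *v g) = cinner q g"
    using cinner_hermitian[OF assms(1), of "matrix_inv B *v q" g]
    by (simp add: matrix_inv_mult_vector[OF assms(2)])
  show ?thesis
    unfolding 1 cinner_diff_left cinner_diff_right 2 cinner_hermitian[OF assms(1)]
    by simp
qed

text \<open>The residuals r and s are free functions tied to e, g, q, dq only almost everywhere.
  This lets one statement serve both for the error, whose residuals are written in the data and the
  approximation, and for the exact solution with residuals f and 0.\<close>

lemma norm1sq_eq_residuals:
  fixes A :: "real^'n::finite \<Rightarrow> complex^'n^'n"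
  assumes \<Omega>: "open \<Omega>" and A: "Linf \<Omega> A"
    and herm: "AE x in lebesgue_on \<Omega>. \<forall>i j. A x $ i $ j = cnj (A x $ j $ i)"
    and \<alpha>: "0 < \<alpha>" and ell: "\<forall>\<phi>. L2v \<Omega> \<phi> \<longrightarrow> \<alpha> * L2vnsq \<Omega> \<phi> \<le> mwnsq \<Omega> A \<phi>"
    and b: "Linf \<Omega> b" and divb: "weak_div \<Omega> (\<lambda>x. cvec (b x)) (\<lambda>x. complex_of_real (divb x))" "Linf \<Omega> divb"
    and c: "Linf \<Omega> c" "0 < c0" "AE x in lebesgue_on \<Omega>. c0 \<le> c x"
    and e: "test_approx \<Omega> \<phi> e g" and g: "L2v \<Omega> g"
    and q: "weak_div \<Omega> q dq" "L2v \<Omega> q" "L2 \<Omega> dq"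
    and R: "L2 \<Omega> r" "AE x in lebesgue_on \<Omega>. r x = complex_of_real (c x) * e x + (bdot (b x) (g x) - dq x)"
    and S: "L2v \<Omega> s" "AE x in lebesgue_on \<Omega>. s x = A x *v g x - q x"
  shows "norm1sq \<Omega> A b c divb e g q dq
    = wnsq \<Omega> (\<lambda>x. 1 / c x) r + mwnsq \<Omega> (\<lambda>x. matrix_inv (A x)) s"
proof -
  let ?M = "lebesgue_on \<Omega>"
  define d where "d = (\<lambda>x. bdot (b x) (g x) - dq x)"
  \<comment> \<open>F1 to F4 are the integrands of the four terms of the norm, G1 and G2 those of
    the two residuals. T1 and T2 belong to the advection term, T3 and T4 to the duality between
    gradient and divergence.\<close>
  define F1 where "F1 = (\<lambda>x. complex_of_real (c x - divb x) * e x * cnj (e x))"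
  define F2 where "F2 = (\<lambda>x. cinner (A x *v g x) (g x))"
  define F3 where "F3 = (\<lambda>x. cinner (matrix_inv (A x) *v q x) (q x))"
  define F4 where "F4 = (\<lambda>x. complex_of_real (1 / c x) * d x * cnj (d x))"
  define G1 where "G1 = (\<lambda>x. complex_of_real (1 / c x) * r x * cnj (r x))"
  define G2 where "G2 = (\<lambda>x. cinner (matrix_inv (A x) *v s x) (s x))"
  define T1 where "T1 = (\<lambda>x. e x * cnj (bdot (b x) (g x)) + cnj (e x) * bdot (b x) (g x))"
  define T2 where "T2 = (\<lambda>x. complex_of_real (divb x) * e x * cnj (e x))"
  define T3 where "T3 = (\<lambda>x. cinner (g x) (q x))"
  define T4 where "T4 = (\<lambda>x. cnj (dq x) * e x)"
  have eL: "L2 \<Omega> e" using e by (simp add: test_approx_def L2conv_def)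
  have bg: "L2 \<Omega> (\<lambda>x. bdot (b x) (g x))" by (rule L2_bdot[OF b g])
  have dL: "L2 \<Omega> d" unfolding d_def by (intro L2_diff bg q)
  have pw: "AE x in ?M. \<forall>v. \<alpha> * (norm v)\<^sup>2 \<le> Re (cinner (A x *v v) v)"
    using ell by (intro pointwise_elliptic[OF \<Omega> A]) blast
  have Ai: "Linf \<Omega> (\<lambda>x. matrix_inv (A x))" by (rule Linf_matrix_inv[OF A \<alpha> pw])
  have ci: "Linf \<Omega> (\<lambda>x. complex_of_real (1 / c x))" by (rule Linf_of_real[OF Linf_inverse[OF c]])
  have iF1: "integrable ?M F1" unfolding F1_def
    by (intro L2_integrable_mult L2_Linf_mult L2_cnj eL Linf_of_real Linf_diff c divb)
  have iF2: "integrable ?M F2" unfolding F2_def by (intro integrable_cinner L2v_matrix_mult A g)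
  have iF3: "integrable ?M F3" unfolding F3_def by (intro integrable_cinner L2v_matrix_mult Ai q)
  have iF4: "integrable ?M F4" unfolding F4_def by (intro L2_integrable_mult L2_Linf_mult[OF ci] L2_cnj dL)
  have iG1: "integrable ?M G1" unfolding G1_def by (intro L2_integrable_mult L2_Linf_mult[OF ci] L2_cnj R)
  have iG2: "integrable ?M G2" unfolding G2_def by (intro integrable_cinner L2v_matrix_mult Ai S)
  have iT1: "integrable ?M T1" unfolding T1_def
    by (intro Bochner_Integration.integrable_add L2_integrable_mult L2_cnj eL bg)
  have iT2: "integrable ?M T2" unfolding T2_def
    by (intro L2_integrable_mult L2_Linf_mult L2_cnj eL Linf_of_real divb)
  have iT3: "integrable ?M T3" unfolding T3_def by (intro integrable_cinner g q)
  have iT4: "integrable ?M T4" unfolding T4_def by (intro L2_integrable_mult L2_cnj eL q)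
  have iT: "integrable ?M (\<lambda>x. cnj (T3 x))" "integrable ?M (\<lambda>x. cnj (T4 x))"
    using iT3 iT4 by simp_all
  note int = iF1 iF2 iF3 iF4 iG1 iG2 iT1 iT2 iT3 iT4 iT
  have "integral\<^sup>L ?M T1 = - integral\<^sup>L ?M T2"
    unfolding T1_def T2_def by (rule advection_test_approx[OF \<Omega> e b divb(2) divb(1)])
  moreover have T34: "integral\<^sup>L ?M T3 = - integral\<^sup>L ?M T4"
  proof -
    have "L2v \<Omega> (\<lambda>x. \<chi> i. cnj (q x $ i))" by (simp add: L2v_iff L2_cnj L2v_nth[OF q(2)])
    from weak_div_test_approx[OF e weak_div_cnj[OF q(1)] this L2_cnj[OF q(3)]]
    show ?thesis by (simp add: T3_def T4_def cinner_def mult.commute)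
  qed
  moreover have "(LINT x|?M. cnj (T3 x)) = - (LINT x|?M. cnj (T4 x))"
    using T34 by (simp add: Bochner_Integration.integral_cnj)
  \<comment> \<open>Each bracket has integral 0: T1 + T2 by advection, T3 + T4 by duality, and the
    last one by conjugating the duality. The part of F1 containing div b is what T2
    compensates.\<close>
  moreover have "(LINT x|?M. F1 x + F2 x + F3 x + F4 x)
      = (LINT x|?M. G1 x + G2 x - (T1 x + T2 x) + (T3 x + T4 x) + (cnj (T3 x) + cnj (T4 x)))"
  proof (rule integral_cong_AE)
    show "AE x in ?M. F1 x + F2 x + F3 x + F4 x
        = G1 x + G2 x - (T1 x + T2 x) + (T3 x + T4 x) + (cnj (T3 x) + cnj (T4 x))"
      using herm pw c(3) R(2) S(2)
    proof eventually_elim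
      case (elim x)
      have "c x \<noteq> 0" using elim(3) c(2) by linarith
      then have G1: "G1 x = complex_of_real (c x) * e x * cnj (e x) + (e x * cnj (d x) + cnj (e x) * d x) + F4 x"
        unfolding G1_def F4_def elim(4) d_def by (rule weighted_square_expand)
      have G2: "G2 x = F2 x - (T3 x + cnj (T3 x)) + F3 x"
        unfolding G2_def F2_def F3_def T3_def elim(5) cnj_cinner
        by (rule inverse_square_expand[OF elim(1) elliptic_invertible[OF \<alpha> elim(2)]])
      show ?case
        unfolding G1 G2 F1_def T1_def T2_def T4_def d_def by (simp add: algebra_simps)
    qed
  qed (intro borel_measurable_integrable Bochner_Integration.integrable_add
      Bochner_Integration.integrable_diff int)+
  ultimately have "integral\<^sup>L ?M F1 + integral\<^sup>L ?M F2 + integral\<^sup>L ?M F3 + integral\<^sup>L ?M F4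
      = integral\<^sup>L ?M G1 + integral\<^sup>L ?M G2"
    by (simp add: Bochner_Integration.integral_add Bochner_Integration.integral_diff int
        del: Bochner_Integration.integral_cnj complex_integrable_cnj)
  then have "Re (integral\<^sup>L ?M F1) + Re (integral\<^sup>L ?M F2) + Re (integral\<^sup>L ?M F3) + Re (integral\<^sup>L ?M F4)
      = Re (integral\<^sup>L ?M G1) + Re (integral\<^sup>L ?M G2)"
    by (metis plus_complex.sel(1))
  then show ?thesis
    unfolding norm1sq_def wnsq_def mwnsq_def F1_def F2_def F3_def F4_def G1_def G2_def d_def .
qed

theorem theorem3p1:
  fixes \<Omega> :: "(real^'n::finite) set"
    and A :: "real^'n \<Rightarrow> complex^'n^'n" and \<alpha> \<beta> :: real
    and b :: "real^'n \<Rightarrow> real^'n" and divb :: "real^'n \<Rightarrow> real"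
    and c :: "real^'n \<Rightarrow> real" and c0 :: real
    and f :: "real^'n \<Rightarrow> complex"
    and u :: "real^'n \<Rightarrow> complex" and gu :: "real^'n \<Rightarrow> complex^'n"
    and p :: "real^'n \<Rightarrow> complex^'n" and dp :: "real^'n \<Rightarrow> complex"
    and ut :: "real^'n \<Rightarrow> complex" and gut :: "real^'n \<Rightarrow> complex^'n"
    and pt :: "real^'n \<Rightarrow> complex^'n" and dpt :: "real^'n \<Rightarrow> complex"
  assumes \<Omega>: "open \<Omega>"
    and A_Linf: "Linf \<Omega> A"
    and A_herm: "AE x in lebesgue_on \<Omega>. \<forall>i j. A x $ i $ j = cnj (A x $ j $ i)"
    and \<alpha>_pos: "0 < \<alpha>" and \<alpha>_\<beta>: "\<alpha> \<le> \<beta>"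
    and A_ell: "\<And>\<phi>. L2v \<Omega> \<phi> \<Longrightarrow> \<alpha> * L2vnsq \<Omega> \<phi> \<le> mwnsq \<Omega> A \<phi> \<and> mwnsq \<Omega> A \<phi> \<le> \<beta> * L2vnsq \<Omega> \<phi>"
    and b_Linf: "Linf \<Omega> b"
    and divb: "weak_div \<Omega> (\<lambda>x. cvec (b x)) (\<lambda>x. complex_of_real (divb x))"
    and divb_Linf: "Linf \<Omega> divb"
    and c_Linf: "Linf \<Omega> c"
    and c0_pos: "0 < c0"
    and c_ge: "AE x in lebesgue_on \<Omega>. c0 \<le> c x"
    and c_divb: "AE x in lebesgue_on \<Omega>. 0 \<le> c x - divb x"
    and f_L2: "L2 \<Omega> f"
    and u_H10: "H10 \<Omega> u" and gu: "weak_grad \<Omega> u gu" and gu_L2: "L2v \<Omega> gu"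
    and p_D: "Hdiv \<Omega> p" and dp: "weak_div \<Omega> p dp" and dp_L2: "L2 \<Omega> dp"
    and P1a: "AE x in lebesgue_on \<Omega>. p x = A x *v gu x"
    and P1b: "AE x in lebesgue_on \<Omega>. - dp x + bdot (b x) (gu x) + complex_of_real (c x) * u x = f x"
    and ut_H10: "H10 \<Omega> ut" and gut: "weak_grad \<Omega> ut gut" and gut_L2: "L2v \<Omega> gut"
    and pt_D: "Hdiv \<Omega> pt" and dpt: "weak_div \<Omega> pt dpt" and dpt_L2: "L2 \<Omega> dpt"
  shows "norm1sq \<Omega> A b c divb (\<lambda>x. u x - ut x) (\<lambda>x. gu x - gut x) (\<lambda>x. p x - pt x) (\<lambda>x. dp x - dpt x)
           = M1 \<Omega> A b c f ut gut pt dpt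
      \<and> (\<not> (AE x in lebesgue_on \<Omega>. f x = 0) \<longrightarrow>
           norm1sq \<Omega> A b c divb (\<lambda>x. u x - ut x) (\<lambda>x. gu x - gut x) (\<lambda>x. p x - pt x) (\<lambda>x. dp x - dpt x)
             / norm1sq \<Omega> A b c divb u gu p dp
           = M1 \<Omega> A b c f ut gut pt dpt / wnsq \<Omega> (\<lambda>x. 1 / c x) f)"
proof -
  have ell: "\<forall>\<phi>. L2v \<Omega> \<phi> \<longrightarrow> \<alpha> * L2vnsq \<Omega> \<phi> \<le> mwnsq \<Omega> A \<phi>"
    using A_ell by blast
  obtain \<phi> where \<phi>: "test_approx \<Omega> \<phi> u gu" by (rule H10_test_approx[OF \<Omega> u_H10 gu gu_L2])
  \<comment> \<open>The approximating sequences of u and of ut are found separately; their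
    difference approximates the error together with its gradient.\<close>
  obtain \<psi> where \<psi>: "test_approx \<Omega> \<psi> ut gut" by (rule H10_test_approx[OF \<Omega> ut_H10 gut gut_L2])
  have p_L2: "L2v \<Omega> p" and pt_L2: "L2v \<Omega> pt" and u_L2: "L2 \<Omega> u" and ut_L2: "L2 \<Omega> ut"
    using p_D pt_D u_H10 ut_H10 by (auto simp: Hdiv_def H10_def)
  note residuals = norm1sq_eq_residuals[OF \<Omega> A_Linf A_herm \<alpha>_pos ell b_Linf divb divb_Linf c_Linf c0_pos c_ge]
  have dq: "weak_div \<Omega> (\<lambda>x. p x - pt x) (\<lambda>x. dp x - dpt x)"
    unfolding weak_div_def
  proof (intro allI impI)
    fix \<eta> assume \<eta>: "test_fun \<Omega> \<eta>"
    have L: "L2 \<Omega> \<eta>" "L2 \<Omega> (pd i \<eta>)" for i by (intro L2_test_fun[OF \<Omega>] \<eta> test_fun_pd)+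
    have i: "integrable (lebesgue_on \<Omega>) (\<lambda>x. (\<Sum>i\<in>UNIV. p x $ i * pd i \<eta> x))"
      "integrable (lebesgue_on \<Omega>) (\<lambda>x. (\<Sum>i\<in>UNIV. pt x $ i * pd i \<eta> x))"
      "integrable (lebesgue_on \<Omega>) (\<lambda>x. dp x * \<eta> x)" "integrable (lebesgue_on \<Omega>) (\<lambda>x. dpt x * \<eta> x)"
      by (intro Bochner_Integration.integrable_sum L2_integrable_mult L2v_nth p_L2 pt_L2 dp_L2 dpt_L2 L)+
    show "(LINT x|lebesgue_on \<Omega>. (\<Sum>i\<in>UNIV. (p x - pt x) $ i * pd i \<eta> x))
        = - (LINT x|lebesgue_on \<Omega>. (dp x - dpt x) * \<eta> x)"
      using dp[unfolded weak_div_def, rule_format, OF \<eta>] dpt[unfolded weak_div_def, rule_format, OF \<eta>]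
      by (simp add: left_diff_distrib sum_subtractf Bochner_Integration.integral_diff i)
  qed
  have err: "norm1sq \<Omega> A b c divb (\<lambda>x. u x - ut x) (\<lambda>x. gu x - gut x) (\<lambda>x. p x - pt x) (\<lambda>x. dp x - dpt x)
      = M1 \<Omega> A b c f ut gut pt dpt"
    unfolding M1_def
  proof (rule residuals[OF test_approx_diff[OF \<phi> \<psi>] _ dq])
    show "L2 \<Omega> (\<lambda>z. f z - complex_of_real (c z) * ut z - bdot (b z) (gut z) + dpt z)"
      by (intro L2_add L2_diff f_L2 L2_Linf_mult Linf_of_real c_Linf ut_L2 L2_bdot b_Linf gut_L2 dpt_L2)
    show "AE x in lebesgue_on \<Omega>. f x - complex_of_real (c x) * ut x - bdot (b x) (gut x) + dpt x
        = complex_of_real (c x) * (u x - ut x) + (bdot (b x) (gu x - gut x) - (dp x - dpt x))"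
      using P1b
    proof eventually_elim
      case (elim x)
      then show ?case
        by (simp add: elim[symmetric] bdot_def right_diff_distrib sum_subtractf)
    qed
    show "L2v \<Omega> (\<lambda>z. pt z - A z *v gut z)"
      by (intro L2v_diff pt_L2 L2v_matrix_mult A_Linf gut_L2)
    show "AE x in lebesgue_on \<Omega>. pt x - A x *v gut x = A x *v (gu x - gut x) - (p x - pt x)"
      using P1a by eventually_elim (simp add: matrix_vector_mult_diff_distrib)
  qed (intro L2v_diff L2_diff gu_L2 gut_L2 p_L2 pt_L2 dp_L2 dpt_L2)+
  have "norm1sq \<Omega> A b c divb u gu p dp
      = wnsq \<Omega> (\<lambda>x. 1 / c x) f + mwnsq \<Omega> (\<lambda>x. matrix_inv (A x)) (\<lambda>x. 0)"
  proof (rule residuals[OF \<phi> gu_L2 dp p_L2 dp_L2 f_L2])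
    show "AE x in lebesgue_on \<Omega>. f x = complex_of_real (c x) * u x + (bdot (b x) (gu x) - dp x)"
      using P1b by eventually_elim (simp add: algebra_simps)
    show "AE x in lebesgue_on \<Omega>. 0 = A x *v gu x - p x"
      using P1a by eventually_elim simp
  qed (simp add: L2v_def)
  moreover have "mwnsq \<Omega> (\<lambda>x. matrix_inv (A x)) (\<lambda>x. 0) = 0"
    by (simp add: mwnsq_def cinner_def)
  ultimately show ?thesis by (simp add: err)
qed

end
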